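(* Let $k$ be a natural number and let $c \in \{5,6\}$. Then there are infinitely many (pairwise non-isomorphic) connected cactus graphs $G$ that have exactly $k$ cycles of length $c$ and that contain exactly $k$ good vertices.
   Context: All graphs are finite, simple, undirected. A cactus is a connected graph in which every edge belongs to at most one cycle. For a connected graph $G$, the Wiener index is $W(G)=\sum_{\{u,v\}\subseteq V(G)} \mathrm{dist}_G(u,v)$, the sum over unordered pairs of distinct vertices; the Wiener index of a disconnected graph is defined to be $\infty$. A vertex $v$ of a connected graph $G$ is good if $W(G)=W(G-v)$, where $G-v$ is obtained by deleting $v$ and its incident edges. *)

theory Defs
  imports Main "HOL-Library.Extended_Nat"
begin

type_synonym 'a graph = "'a set \<times> 'a set set"

definition simple_graph :: "'a graph \<Rightarrow> bool" where
  "simple_graph G \<longleftrightarrow> finite (fst G) \<and>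
     (\<forall>e\<in>snd G. \<exists>u v. u \<noteq> v \<and> e = {u, v} \<and> u \<in> fst G \<and> v \<in> fst G)"

definition adj :: "'a graph \<Rightarrow> 'a \<Rightarrow> 'a \<Rightarrow> bool" where
  "adj G u v \<longleftrightarrow> {u, v} \<in> snd G"

definition walk :: "'a graph \<Rightarrow> 'a list \<Rightarrow> bool" where
  "walk G xs \<longleftrightarrow> xs \<noteq> [] \<and> set xs \<subseteq> fst G \<and>
     (\<forall>i. i + 1 < length xs \<longrightarrow> adj G (xs ! i) (xs ! (i + 1)))"

definition connected_graph :: "'a graph \<Rightarrow> bool" where
  "connected_graph G \<longleftrightarrow>
     (\<forall>u\<in>fst G. \<forall>v\<in>fst G. \<exists>xs. walk G xs \<and> hd xs = u \<and> last xs = v)"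

definition gdist :: "'a graph \<Rightarrow> 'a \<Rightarrow> 'a \<Rightarrow> nat" where
  "gdist G u v = (LEAST n. \<exists>xs. walk G xs \<and> hd xs = u \<and> last xs = v \<and> length xs = n + 1)"

definition wiener :: "'a graph \<Rightarrow> enat" where
  "wiener G = (if connected_graph G
     then enat (\<Sum>e\<in>{e. e \<subseteq> fst G \<and> card e = 2}.
                  gdist G (SOME u. u \<in> e) (SOME v. v \<in> e \<and> v \<noteq> (SOME u. u \<in> e)))
     else \<infinity>)"

definition delete_vertex :: "'a graph \<Rightarrow> 'a \<Rightarrow> 'a graph" where
  "delete_vertex G v = (fst G - {v}, {e\<in>snd G. v \<notin> e})"

definition good_vertex :: "'a graph \<Rightarrow> 'a \<Rightarrow> bool" where
  "good_vertex G v \<longleftrightarrow> v \<in> fst G \<and> wiener G = wiener (delete_vertex G v)"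

definition is_cycle :: "'a graph \<Rightarrow> 'a set set \<Rightarrow> bool" where
  "is_cycle G C \<longleftrightarrow> C \<subseteq> snd G \<and>
     (\<exists>vs. length vs \<ge> 3 \<and> distinct vs \<and> set vs \<subseteq> fst G \<and>
        C = {{vs ! i, vs ! ((i + 1) mod length vs)} | i. i < length vs})"

definition cycles_of_length :: "'a graph \<Rightarrow> nat \<Rightarrow> 'a set set set" where
  "cycles_of_length G c = {C. is_cycle G C \<and> card C = c}"

definition cactus :: "'a graph \<Rightarrow> bool" where
  "cactus G \<longleftrightarrow> simple_graph G \<and> fst G \<noteq> {} \<and> connected_graph G \<and>
     (\<forall>e\<in>snd G. card {C. is_cycle G C \<and> e \<in> C} \<le> 1)"

definition graph_iso :: "'a graph \<Rightarrow> 'b graph \<Rightarrow> bool" where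
  "graph_iso G H \<longleftrightarrow> (\<exists>f. bij_betw f (fst G) (fst H) \<and>
     (\<forall>u\<in>fst G. \<forall>v\<in>fst G. {u, v} \<in> snd G \<longleftrightarrow> {f u, f v} \<in> snd H))"

end

theory Submission
  imports Defs
begin

text \<open>
  Glue two connected graphs \<open>A\<close> and \<open>B\<close>, having \<open>m\<close> and \<open>n\<close> vertices besides the common vertex
  \<open>r\<close>. With \<open>D\<close> the sum of distances over ordered pairs and \<open>T\<close> the sum of distances from \<open>r\<close>,
  \<open>D (glue A B) = D A + D B + 2 * (n * T A + m * T B)\<close>. So whether a vertex \<open>v\<close> of \<open>B\<close> is good
  depends only on \<open>m\<close>, \<open>T A\<close> and finitely many numbers attached to \<open>B\<close> and \<open>B - v\<close>.
  Glue \<open>k\<close> copies of a fixed graph \<open>B\<close> (a cycle of length \<open>c\<close> through \<open>r\<close>, with some leaves at one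
  vertex) to a caterpillar whose leaf counts are adjustable. Leaves of a graph are never good, and
  neither are their neighbours, being cut vertices; this leaves only the degree 2 vertices of the
  cycles. For the one next to both \<open>r\<close> and the leaf-bearing vertex, goodness becomes a linear
  equation between \<open>m\<close> and \<open>T A\<close>, solved by choosing the leaf counts; for the others deletion
  decreases the Wiener index. Cycles are identified by the fact that a cycle passing through a
  vertex uses exactly two of its edges.
\<close>

subsection \<open>Breadth-first certificates and the Wiener index\<close>

lemma walk_single: "walk G [v] \<longleftrightarrow> v \<in> fst G"
  by (simp add: walk_def)

text \<open>Turns the index-based definition of a walk into a recursion at its right end, the form
  in which the inductions over walks use it.\<close>

lemma walk_snoc:
  assumes "xs \<noteq> []"
  shows "walk G (xs @ [v]) \<longleftrightarrow> walk G xs \<and> v \<in> fst G \<and> adj G (last xs) v"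
proof -
  have "(\<forall>i. i + 1 < length (xs @ [v]) \<longrightarrow> adj G ((xs @ [v]) ! i) ((xs @ [v]) ! (i + 1))) \<longleftrightarrow>
    (\<forall>i. i + 1 < length xs \<longrightarrow> adj G (xs ! i) (xs ! (i + 1))) \<and> adj G (last xs) v" (is "?L \<longleftrightarrow> ?R")
  proof
    assume L: ?L
    have "adj G (last xs) v"
      using L[rule_format, of "length xs - 1"] assms by (simp add: nth_append last_conv_nth)
    moreover have "adj G (xs ! i) (xs ! (i + 1))" if "i + 1 < length xs" for i
      using L[rule_format, of i] that by (simp add: nth_append)
    ultimately show ?R by blast
  next
    assume R: ?R
    show ?L
    proof (intro allI impI)
      fix i assume i: "i + 1 < length (xs @ [v])"
      show "adj G ((xs @ [v]) ! i) ((xs @ [v]) ! (i + 1))"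
      proof (cases "i + 1 < length xs")
        case True
        then show ?thesis using R by (simp add: nth_append)
      next
        case False
        with i have "length xs = i + 1" by simp
        then show ?thesis using R assms by (simp add: nth_append last_conv_nth)
      qed
    qed
  qed
  then show ?thesis using assms by (auto simp: walk_def)
qed

lemma adj_sym: "adj G u v \<longleftrightarrow> adj G v u"
  by (simp add: adj_def insert_commute)

lemma walk_rev: "walk G xs \<Longrightarrow> walk G (rev xs)"
proof -
  assume w: "walk G xs"
  have "adj G (rev xs ! i) (rev xs ! (i + 1))" if "i + 1 < length xs" for i
  proof -
    define j where "j = length xs - Suc (Suc i)"
    have "j + 1 < length xs" "rev xs ! i = xs ! (j + 1)" "rev xs ! (i + 1) = xs ! j"
      using that by (auto simp: j_def rev_nth Suc_diff_Suc)
    then show ?thesis using w by (auto simp: walk_def adj_sym)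
  qed
  then show ?thesis using w by (auto simp: walk_def)
qed

lemma walk_append:
  assumes "walk G xs" "walk G ys" "last xs = hd ys"
  shows "walk G (xs @ tl ys)"
  using assms(2,3)
proof (induction ys rule: rev_induct)
  case Nil
  then show ?case by (simp add: walk_def)
next
  case (snoc y ys)
  show ?case
  proof (cases "ys = []")
    case True
    then show ?thesis using assms(1) by simp
  next
    case False
    with snoc have "walk G (xs @ tl ys)" "adj G (last ys) y" "y \<in> fst G" 
      by (auto simp: walk_snoc)
    moreover have "last (xs @ tl ys) = last ys"
      using False snoc.prems(2) by (cases ys) auto
    moreover have "xs \<noteq> []" using assms(1) by (simp add: walk_def)
    ultimately show ?thesis
      using False walk_snoc[of "xs @ tl ys" G y] by simp
  qed
qed

text \<open>A local certificate, as produced by breadth-first search, that \<open>f\<close> is the distance from \<open>u\<close>.\<close>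

definition level :: "'a graph \<Rightarrow> 'a \<Rightarrow> ('a \<Rightarrow> nat) \<Rightarrow> bool" where
  "level G u f \<longleftrightarrow> u \<in> fst G \<and> f u = 0 \<and>
     (\<forall>x\<in>fst G. \<forall>y\<in>fst G. adj G x y \<longrightarrow> f y \<le> f x + 1) \<and>
     (\<forall>v\<in>fst G. v \<noteq> u \<longrightarrow> (\<exists>w\<in>fst G. adj G w v \<and> f v = f w + 1))"

text \<open>Passing to a predecessor lowers the level by one, so tracing predecessors back from
  \<open>v\<close> ends at the only vertex of level 0, which is \<open>u\<close>.\<close>

lemma level_walk_exists:
  assumes "level G u f" "v \<in> fst G"
  shows "\<exists>xs. walk G xs \<and> hd xs = u \<and> last xs = v \<and> length xs = f v + 1"
  using assms(2)
proof (induction "f v" arbitrary: v)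
  case 0
  then have "v = u" using assms(1) unfolding level_def by fastforce
  then show ?case using 0 by (intro exI[of _ "[u]"]) (simp add: walk_single)
next
  case (Suc n)
  then have "v \<noteq> u" using assms(1) unfolding level_def by auto
  then obtain w where w: "w \<in> fst G" "adj G w v" "f v = f w + 1"
    using assms(1) Suc.prems unfolding level_def by blast
  then obtain xs where xs: "walk G xs" "hd xs = u" "last xs = w" "length xs = f w + 1"
    using Suc.hyps by (metis Suc_eq_plus1 Suc_inject)
  then have "xs \<noteq> []" by (simp add: walk_def)
  then show ?case using xs w Suc.prems
    by (intro exI[of _ "xs @ [v]"]) (simp add: walk_snoc)
qed

text \<open>A function growing by at most 1 along each edge bounds walk lengths from below. The
  \<open>+ 1\<close> is there because \<open>length xs\<close> counts vertices, one more than edges.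
  It serves both for lower bounds on distances and for proving a graph disconnected.\<close>

lemma walk_lipschitz:
  assumes "walk G xs"
    and "\<And>x y. x \<in> fst G \<Longrightarrow> y \<in> fst G \<Longrightarrow> adj G x y \<Longrightarrow> f y \<le> f x + (1::nat)"
  shows "f (last xs) + 1 \<le> f (hd xs) + length xs"
  using assms(1)
proof (induction xs rule: rev_induct)
  case Nil
  then show ?case by (simp add: walk_def)
next
  case (snoc y ys)
  show ?case
  proof (cases "ys = []")
    case False
    with snoc.prems have y: "walk G ys" "y \<in> fst G" "adj G (last ys) y"
      by (auto simp: walk_snoc)
    then have "last ys \<in> fst G" using False by (auto simp: walk_def)
    then have "f y \<le> f (last ys) + 1" using assms(2) y by blast
    moreover have "f (last ys) + 1 \<le> f (hd ys) + length ys" using snoc.IH y by simp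
    ultimately show ?thesis using False by simp
  qed simp
qed

lemma level_gdist:
  assumes "level G u f" "v \<in> fst G"
  shows "gdist G u v = f v"
  unfolding gdist_def
proof (rule Least_equality)
  show "\<exists>xs. walk G xs \<and> hd xs = u \<and> last xs = v \<and> length xs = f v + 1"
    using level_walk_exists[OF assms] .
next
  fix n assume "\<exists>xs. walk G xs \<and> hd xs = u \<and> last xs = v \<and> length xs = n + 1"
  then obtain xs where "walk G xs" "hd xs = u" "last xs = v" "length xs = n + 1" by blast
  then show "f v \<le> n"
    using walk_lipschitz[of G xs f] assms(1) unfolding level_def by auto
qed

lemma level_connected:
  assumes "level G r f"
  shows "connected_graph G"
  unfolding connected_graph_def
proof (intro ballI)
  fix u v assume "u \<in> fst G" "v \<in> fst G"
  then obtain xs ys where xs: "walk G xs" "hd xs = r" "last xs = u"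
    and ys: "walk G ys" "hd ys = r" "last ys = v"
    using level_walk_exists[OF assms] by blast
  have ne: "xs \<noteq> []" "ys \<noteq> []" using xs ys by (auto simp: walk_def)
  have "walk G (rev xs @ tl ys)"
    using xs ys ne by (intro walk_append walk_rev) (auto simp: last_rev)
  moreover have "hd (rev xs @ tl ys) = u" using xs ne by (simp add: hd_rev)
  moreover have "last (rev xs @ tl ys) = v"
  proof (cases "tl ys = []")
    case True
    then show ?thesis using xs ys ne by (cases ys) (auto simp: last_rev)
  next
    case False
    then show ?thesis using ys ne by (cases ys) auto
  qed
  ultimately show "\<exists>xs. walk G xs \<and> hd xs = u \<and> last xs = v" by blast
qed

lemma gdist_le_walk:
  assumes "walk G xs" "hd xs = u" "last xs = v"
  shows "gdist G u v + 1 \<le> length xs"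
proof -
  have "xs \<noteq> []" using assms by (simp add: walk_def)
  then have "length xs = (length xs - 1) + 1" by (cases xs) auto
  then have "gdist G u v \<le> length xs - 1"
    unfolding gdist_def using assms by (intro Least_le) blast
  then show ?thesis using \<open>xs \<noteq> []\<close> by (cases xs) auto
qed

lemma shortest_walk:
  assumes "connected_graph G" "u \<in> fst G" "v \<in> fst G"
  shows "\<exists>xs. walk G xs \<and> hd xs = u \<and> last xs = v \<and> length xs = gdist G u v + 1"
  unfolding gdist_def
proof (rule LeastI_ex)
  obtain xs where xs: "walk G xs" "hd xs = u" "last xs = v"
    using assms unfolding connected_graph_def by blast
  then have "length xs = (length xs - 1) + 1" by (cases xs) (auto simp: walk_def)
  then show "\<exists>n xs. walk G xs \<and> hd xs = u \<and> last xs = v \<and> length xs = n + 1"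
    using xs by blast
qed

text \<open>Converse of \<open>level_gdist\<close>: in a connected graph the distance function is
  itself a certificate. Later proofs can therefore reason about distances edge by edge, without
  handling walks.\<close>

lemma level_gdist_connected:
  assumes "connected_graph G" "u \<in> fst G"
  shows "level G u (gdist G u)"
  unfolding level_def
proof (intro conjI ballI impI)
  show "gdist G u u = 0"
    using gdist_le_walk[of G "[u]" u u] assms by (simp add: walk_single)
  have lip: "gdist G u y \<le> gdist G u x + 1" if xy: "x \<in> fst G" "y \<in> fst G" "adj G x y" for x y
  proof -
    obtain xs where xs: "walk G xs" "hd xs = u" "last xs = x" "length xs = gdist G u x + 1"
      using shortest_walk[OF assms xy(1)] by blast
    then have "xs \<noteq> []" by (simp add: walk_def)
    then show ?thesis
      using gdist_le_walk[of G "xs @ [y]" u y] xs xy by (simp add: walk_snoc)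
  qed
  then show "gdist G u y \<le> gdist G u x + 1" if "x \<in> fst G" "y \<in> fst G" "adj G x y" for x y
    using that by blast
  fix v assume v: "v \<in> fst G" "v \<noteq> u"
  obtain xs where xs: "walk G xs" "hd xs = u" "last xs = v" "length xs = gdist G u v + 1"
    using shortest_walk[OF assms v(1)] by blast
  then obtain ys where ys: "xs = ys @ [v]" 
    by (metis append_butlast_last_id walk_def)
  have ne: "ys \<noteq> []" using ys xs v by auto
  have w: "walk G ys" "adj G (last ys) v" using xs ys walk_snoc[OF ne] by auto
  have m: "last ys \<in> fst G" using w ne by (auto simp: walk_def)
  \<comment> \<open>Dropping the last vertex of a shortest walk leaves a walk to a neighbour of
    \<open>v\<close>, which is then exactly one step closer to \<open>u\<close>.\<close>
  have "gdist G u (last ys) + 1 \<le> length ys"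
    using gdist_le_walk[OF w(1)] xs ys ne by auto
  moreover have "gdist G u v \<le> gdist G u (last ys) + 1" using lip m v w by blast
  ultimately have "gdist G u v = gdist G u (last ys) + 1" using xs ys by simp
  then show "\<exists>w\<in>fst G. adj G w v \<and> gdist G u v = gdist G u w + 1" using m w by blast
qed (use assms in auto)

lemma gdist_sym: "gdist G u v = gdist G v u"
proof -
  have "\<exists>ys. walk G ys \<and> hd ys = v \<and> last ys = u \<and> length ys = m"
    if "walk G xs \<and> hd xs = u \<and> last xs = v \<and> length xs = m" for u v m xs
    using that by (intro exI[of _ "rev xs"]) (auto simp: walk_rev hd_rev last_rev)
  then have "(\<exists>xs. walk G xs \<and> hd xs = u \<and> last xs = v \<and> length xs = m) \<longleftrightarrow>
    (\<exists>xs. walk G xs \<and> hd xs = v \<and> last xs = u \<and> length xs = m)" for m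
    by blast
  then show ?thesis unfolding gdist_def by simp
qed

section \<open>Ordered distance sums and the Wiener index\<close>

definition trans_sum :: "'a graph \<Rightarrow> 'a \<Rightarrow> nat" where
  "trans_sum G r = (\<Sum>v\<in>fst G. gdist G r v)"

definition dist_sum :: "'a graph \<Rightarrow> nat" where
  "dist_sum G = (\<Sum>u\<in>fst G. trans_sum G u)"

text \<open>Induction on \<open>V\<close>: a new vertex \<open>x\<close> brings the pairs {x, y},
  each counted once on the left and in both orders on the right. Values of \<open>h\<close> are
  prescribed only on two-element sets, to fit the choice of ends made in
  \<open>wiener\<close>.\<close>

lemma sum_unordered_pairs:
  fixes d :: "'a \<Rightarrow> 'a \<Rightarrow> nat"
  assumes "finite V" "\<And>x y. d x y = d y x" "\<And>x. x \<in> V \<Longrightarrow> d x x = 0"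
    "\<And>x y. x \<noteq> y \<Longrightarrow> h {x, y} = d x y"
  shows "2 * (\<Sum>e\<in>{e. e \<subseteq> V \<and> card e = 2}. h e) = (\<Sum>x\<in>V. \<Sum>y\<in>V. d x y)"
  using assms(1,3)
proof (induction V rule: finite_induct)
  case empty
  have "{e. e \<subseteq> {} \<and> card e = 2} = ({} :: 'a set set)" by auto
  then show ?case by simp
next
  case (insert x V)
  let ?P = "\<lambda>V. {e. e \<subseteq> V \<and> card e = 2}"
  have P: "?P (insert x V) = ?P V \<union> (\<lambda>y. {x, y}) ` V"
  proof (intro equalityI subsetI)
    fix e assume "e \<in> ?P (insert x V)"
    then show "e \<in> ?P V \<union> (\<lambda>y. {x, y}) ` V"
      by (fastforce simp: card_2_iff)
  next
    fix e assume "e \<in> ?P V \<union> (\<lambda>y. {x, y}) ` V"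
    then show "e \<in> ?P (insert x V)" using insert.hyps(2) by (auto simp: card_2_iff)
  qed
  have "sum h ((\<lambda>y. {x, y}) ` V) = (\<Sum>y\<in>V. h {x, y})"
    using insert.hyps(2) by (subst sum.reindex) (auto simp: inj_on_def doubleton_eq_iff)
  also have "\<dots> = (\<Sum>y\<in>V. d x y)"
    using insert.hyps(2) by (intro sum.cong refl assms(4)) auto
  finally have im: "sum h ((\<lambda>y. {x, y}) ` V) = (\<Sum>y\<in>V. d x y)" .
  have "sum h (?P (insert x V)) = sum h (?P V) + sum h ((\<lambda>y. {x, y}) ` V)"
    unfolding P using insert.hyps by (intro sum.union_disjoint) auto
  moreover have "(\<Sum>y\<in>V. d y x) = (\<Sum>y\<in>V. d x y)" using assms(2) by simp
  ultimately show ?case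
    using insert im by (simp add: sum.distrib)
qed

text \<open>The two \<open>SOME\<close> terms in \<open>wiener\<close> return the elements of a pair
  in an unknown order; by symmetry of the distance the order is irrelevant. Doubling avoids dividing
  \<open>dist_sum\<close> by 2.\<close>

lemma wiener_dist_sum:
  assumes "finite (fst G)" "connected_graph G"
  shows "\<exists>w. wiener G = enat w \<and> 2 * w = dist_sum G"
proof -
  let ?h = "\<lambda>e. gdist G (SOME u. u \<in> e) (SOME v. v \<in> e \<and> v \<noteq> (SOME u. u \<in> e))"
  have h: "?h {x, y} = gdist G x y" if "x \<noteq> y" for x y
  proof -
    define a where "a = (SOME u. u \<in> {x, y})"
    define b where "b = (SOME v. v \<in> {x, y} \<and> v \<noteq> a)"
    have a: "a \<in> {x, y}" unfolding a_def by (rule someI[of _ x]) simp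
    then have "\<exists>v. v \<in> {x, y} \<and> v \<noteq> a" using that by auto
    then have "b \<in> {x, y} \<and> b \<noteq> a" unfolding b_def by (rule someI_ex)
    then have "gdist G a b = gdist G x y" using a gdist_sym[of G x y] by auto
    then show ?thesis unfolding a_def b_def .
  qed
  have "2 * (\<Sum>e\<in>{e. e \<subseteq> fst G \<and> card e = 2}. ?h e) = (\<Sum>x\<in>fst G. \<Sum>y\<in>fst G. gdist G x y)"
  proof (rule sum_unordered_pairs[OF assms(1)])
    show "gdist G x x = 0" if "x \<in> fst G" for x
      using level_gdist_connected[OF assms(2) that] by (simp add: level_def)
  qed (fact gdist_sym h)+
  then show ?thesis
    using assms(2) by (simp add: wiener_def dist_sum_def trans_sum_def)
qed

lemma wiener_eq_iff:
  assumes "finite (fst G)" "connected_graph G" "finite (fst H)" "connected_graph H"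
  shows "wiener G = wiener H \<longleftrightarrow> dist_sum G = dist_sum H"
  using wiener_dist_sum[OF assms(1,2)] wiener_dist_sum[OF assms(3,4)] by auto

subsection \<open>Gluing graphs at a vertex\<close>

text \<open>Guarantees that every edge of a glued graph joins two vertices of the same part.\<close>

definition edges_within :: "'a graph \<Rightarrow> bool" where
  "edges_within G \<longleftrightarrow> (\<forall>e\<in>snd G. e \<subseteq> fst G)"

lemma simple_graph_edges_within: "simple_graph G \<Longrightarrow> edges_within G"
  by (fastforce simp: simple_graph_def edges_within_def)

lemma gdist_self: "connected_graph G \<Longrightarrow> u \<in> fst G \<Longrightarrow> gdist G u u = 0"
  using level_gdist_connected[of G u] by (simp add: level_def)

lemma gdist_step:
  assumes "connected_graph G" "u \<in> fst G" "x \<in> fst G" "y \<in> fst G" "adj G x y"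
  shows "gdist G u y \<le> gdist G u x + 1"
  using level_gdist_connected[OF assms(1,2)] assms(3-) by (simp add: level_def)

lemma gdist_pred:
  assumes "connected_graph G" "u \<in> fst G" "v \<in> fst G" "v \<noteq> u"
  obtains w where "w \<in> fst G" "adj G w v" "gdist G u v = gdist G u w + 1"
  using level_gdist_connected[OF assms(1,2)] assms(3-) by (fastforce simp: level_def)

definition glue :: "'a graph \<Rightarrow> 'a graph \<Rightarrow> 'a graph" where
  "glue A B = (fst A \<union> fst B, snd A \<union> snd B)"

lemma glue_commute: "glue A B = glue B A"
  by (simp add: glue_def Un_commute)

text \<open>A path from \<open>A\<close> into the rest of \<open>B\<close> has to pass through
  \<open>r\<close>, so the distance is the sum of the two parts. Checking the certificate locally
  replaces the cutting of walks at \<open>r\<close>.\<close>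

lemma level_glue:
  assumes "connected_graph A" "connected_graph B" "edges_within A" "edges_within B"
    "fst A \<inter> fst B = {r}" "u \<in> fst A"
  shows "level (glue A B) u (\<lambda>x. if x \<in> fst A then gdist A u x else gdist A u r + gdist B r x)"
    (is "level _ _ ?f")
proof -
  have r: "r \<in> fst A" "r \<in> fst B" using assms by auto
  \<comment> \<open>The second branch of \<open>?f\<close> is also correct at the common vertex
    \<open>r\<close>, where both branches agree; so edges inside \<open>B\<close> need no case
    distinction.\<close>
  have fB: "?f x = gdist A u r + gdist B r x" if "x \<in> fst B" for x
  proof (cases "x \<in> fst A")
    case True
    then have "x = r" using that assms by auto
    then show ?thesis using gdist_self[OF assms(2) r(2)] r by simp
  qed simp
  show ?thesis
    unfolding level_def
  proof (intro conjI ballI impI)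
    show "u \<in> fst (glue A B)" using assms by (simp add: glue_def)
    show "?f u = 0" using assms gdist_self by simp
    fix x y assume "x \<in> fst (glue A B)" "y \<in> fst (glue A B)" "adj (glue A B) x y"
    then consider "x \<in> fst A" "y \<in> fst A" "adj A x y" | "x \<in> fst B" "y \<in> fst B" "adj B x y"
      using assms(3,4) by (fastforce simp: adj_def glue_def edges_within_def)
    then show "?f y \<le> ?f x + 1"
    proof cases
      case 1
      then show ?thesis using gdist_step[OF assms(1,6)] by simp
    next
      case 2
      then show ?thesis using gdist_step[OF assms(2) r(2)] fB by simp
    qed
  next
    fix v assume v: "v \<in> fst (glue A B)" "v \<noteq> u"
    show "\<exists>w\<in>fst (glue A B). adj (glue A B) w v \<and> ?f v = ?f w + 1"
    proof (cases "v \<in> fst A")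
      case True
      from gdist_pred[OF assms(1,6) True v(2)] obtain w where
        "w \<in> fst A" "adj A w v" "gdist A u v = gdist A u w + 1" .
      then show ?thesis using True by (intro bexI[of _ w]) (auto simp: glue_def adj_def)
    next
      case False
      then have vB: "v \<in> fst B" "v \<noteq> r" using v r by (auto simp: glue_def)
      from gdist_pred[OF assms(2) r(2) vB] obtain w where
        w: "w \<in> fst B" "adj B w v" "gdist B r v = gdist B r w + 1" .
      then have "?f v = ?f w + 1" using fB vB by simp
      then show ?thesis using w by (intro bexI[of _ w]) (auto simp: glue_def adj_def)
    qed
  qed
qed

lemma connected_glue:
  assumes "connected_graph A" "connected_graph B" "edges_within A" "edges_within B"
    "fst A \<inter> fst B = {r}"
  shows "connected_graph (glue A B)"
  using level_glue[OF assms, of r] assms(5) by (intro level_connected) auto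

text \<open>Each of the \<open>n\<close> vertices of \<open>B\<close> other than \<open>r\<close> is
  reached through \<open>r\<close>, at the extra cost \<open>gdist A u r\<close>.\<close>

lemma trans_sum_glue:
  assumes "connected_graph A" "connected_graph B" "edges_within A" "edges_within B"
    "fst A \<inter> fst B = {r}" "finite (fst A)" "finite (fst B)" "card (fst B) = Suc n" "u \<in> fst A"
  shows "trans_sum (glue A B) u = trans_sum A u + n * gdist A u r + trans_sum B r"
proof -
  let ?f = "\<lambda>x. if x \<in> fst A then gdist A u x else gdist A u r + gdist B r x"
  have r: "r \<in> fst B" using assms by auto
  have "trans_sum (glue A B) u = (\<Sum>x\<in>fst A \<union> (fst B - {r}). ?f x)"
    unfolding trans_sum_def using assms(5)
    by (intro sum.cong level_gdist[OF level_glue[OF assms(1-5,9)]]) (auto simp: glue_def)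
  also have "\<dots> = (\<Sum>x\<in>fst A. ?f x) + (\<Sum>x\<in>fst B - {r}. ?f x)"
    using assms by (intro sum.union_disjoint) auto
  also have "(\<Sum>x\<in>fst B - {r}. ?f x) = (\<Sum>x\<in>fst B - {r}. gdist A u r + gdist B r x)"
    using assms(5) by (intro sum.cong) auto
  also have "\<dots> = n * gdist A u r + (\<Sum>x\<in>fst B - {r}. gdist B r x)"
    using assms r by (simp add: sum.distrib)
  also have "(\<Sum>x\<in>fst B - {r}. gdist B r x) = trans_sum B r"
    unfolding trans_sum_def using assms r gdist_self[OF assms(2) r]
    by (simp add: sum.remove[of _ r])
  finally show ?thesis by (simp add: trans_sum_def)
qed

text \<open>Sum \<open>trans_sum_glue\<close> over the sources in \<open>A\<close> and, with the
  roles exchanged, over those in \<open>B\<close>; the source \<open>r\<close> is then counted twice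
  and is subtracted once.\<close>

lemma dist_sum_glue:
  assumes "connected_graph A" "connected_graph B" "edges_within A" "edges_within B"
    "fst A \<inter> fst B = {r}" "finite (fst A)" "finite (fst B)"
    "card (fst A) = Suc m" "card (fst B) = Suc n"
  shows "dist_sum (glue A B) =
    dist_sum A + dist_sum B + 2 * (n * trans_sum A r + m * trans_sum B r)"
proof -
  have r: "r \<in> fst A" "r \<in> fst B" using assms by auto
  have BA: "fst B \<inter> fst A = {r}" using assms by auto
  have sumd: "(\<Sum>u\<in>fst G. gdist G u r) = trans_sum G r" for G
    unfolding trans_sum_def by (simp add: gdist_sym[of G r])
  have A: "(\<Sum>u\<in>fst A. trans_sum (glue A B) u) =
      dist_sum A + n * trans_sum A r + Suc m * trans_sum B r"
    using trans_sum_glue[OF assms(1-7,9)]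
    by (simp add: dist_sum_def sum.distrib sum_distrib_left[symmetric] sumd assms)
  have B: "(\<Sum>u\<in>fst B. trans_sum (glue A B) u) =
      dist_sum B + m * trans_sum B r + Suc n * trans_sum A r"
    using trans_sum_glue[OF assms(2,1,4,3) BA assms(7,6,8)]
    by (simp add: dist_sum_def sum.distrib sum_distrib_left[symmetric] sumd assms
        glue_commute[of A B])
  have R: "trans_sum (glue A B) r = trans_sum A r + trans_sum B r"
    using trans_sum_glue[OF assms(1-7,9) r(1)] gdist_self[OF assms(1) r(1)] by simp
  have "fst (glue A B) = fst A \<union> (fst B - {r})" "fst A \<inter> (fst B - {r}) = {}"
    using r assms(5) by (auto simp: glue_def)
  then have "dist_sum (glue A B) = (\<Sum>u\<in>fst A. trans_sum (glue A B) u)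
      + (\<Sum>u\<in>fst B - {r}. trans_sum (glue A B) u)"
    unfolding dist_sum_def using assms by (simp add: sum.union_disjoint)
  moreover have "(\<Sum>u\<in>fst B. trans_sum (glue A B) u) =
      trans_sum (glue A B) r + (\<Sum>u\<in>fst B - {r}. trans_sum (glue A B) u)"
    using assms r by (simp add: sum.remove)
  ultimately show ?thesis using A B R by simp
qed

section \<open>Deleting a vertex of one glued part\<close>

lemma fst_delete_vertex [simp]: "fst (delete_vertex G v) = fst G - {v}"
  by (simp add: delete_vertex_def)

lemma edges_within_delete: "edges_within G \<Longrightarrow> edges_within (delete_vertex G v)"
  by (auto simp: edges_within_def delete_vertex_def)

lemma delete_vertex_glue:
  assumes "edges_within A" "v \<notin> fst A"
  shows "delete_vertex (glue A B) v = glue A (delete_vertex B v)"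
proof -
  have "{e \<in> snd A. v \<notin> e} = snd A" using assms by (auto simp: edges_within_def)
  then show ?thesis using assms(2) unfolding delete_vertex_def glue_def by auto
qed

text \<open>Compare \<open>dist_sum_glue\<close> for \<open>B\<close> and for \<open>B\<close>
  without \<open>v\<close>. The term \<open>dist_sum A\<close> cancels, and since the second part
  has lost one vertex, exactly one copy of \<open>2 * trans_sum A r\<close> survives.\<close>

lemma good_vertex_glue:
  assumes A: "connected_graph A" "edges_within A" "finite (fst A)" "card (fst A) = Suc m"
    and B: "connected_graph B" "edges_within B" "finite (fst B)"
    and AB: "fst A \<inter> fst B = {r}"
    and v: "v \<in> fst B" "v \<noteq> r" "connected_graph (delete_vertex B v)"
  shows "good_vertex (glue A B) v \<longleftrightarrow>
    dist_sum B + 2 * trans_sum A r + 2 * m * trans_sum B r =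
    dist_sum (delete_vertex B v) + 2 * m * trans_sum (delete_vertex B v) r"
proof -
  let ?D = "delete_vertex B v"
  have r: "r \<in> fst B" using AB by auto
  then have "{r, v} \<subseteq> fst B" using v by simp
  then have "card {r, v} \<le> card (fst B)" using B by (intro card_mono)
  \<comment> \<open>Here \<open>n\<close> counts the vertices of \<open>B\<close> other than both
    \<open>r\<close> and \<open>v\<close>.\<close>
  then obtain n where n: "card (fst B) = Suc (Suc n)"
    using v(2) by (cases "card (fst B)"; cases "card (fst B) - 1") auto
  have vA: "v \<notin> fst A" using AB v by auto
  have D: "edges_within ?D" "fst A \<inter> fst ?D = {r}" "finite (fst ?D)" "card (fst ?D) = Suc n"
    using edges_within_delete[OF B(2)] AB B v n vA by auto
  have "good_vertex (glue A B) v \<longleftrightarrow> wiener (glue A B) = wiener (glue A ?D)"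
    unfolding good_vertex_def delete_vertex_glue[OF A(2) vA] using v by (simp add: glue_def)
  also have "\<dots> \<longleftrightarrow> dist_sum (glue A B) = dist_sum (glue A ?D)"
    using A B D connected_glue[OF A(1) B(1) A(2) B(2) AB] connected_glue[OF A(1) v(3) A(2) D(1,2)]
    by (intro wiener_eq_iff) (auto simp: glue_def)
  also have "\<dots> \<longleftrightarrow> dist_sum B + 2 * trans_sum A r + 2 * m * trans_sum B r =
    dist_sum ?D + 2 * m * trans_sum ?D r"
    using dist_sum_glue[OF A(1) B(1) A(2) B(2) AB A(3) B(3) A(4) n]
      dist_sum_glue[OF A(1) v(3) A(2) D(1,2) A(3) D(3) A(4) D(4)]
    by (auto simp: algebra_simps)
  finally show ?thesis .
qed

section \<open>Copies of a graph along an injective map\<close>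

definition graph_image :: "('a \<Rightarrow> 'b) \<Rightarrow> 'a graph \<Rightarrow> 'b graph" where
  "graph_image f G = (f ` fst G, (`) f ` snd G)"

lemma edges_within_image: "edges_within G \<Longrightarrow> edges_within (graph_image f G)"
  by (simp add: edges_within_def graph_image_def image_mono)

lemma adj_graph_image:
  assumes "inj_on f (fst G)" "edges_within G" "x \<in> fst G" "y \<in> fst G"
  shows "adj (graph_image f G) (f x) (f y) \<longleftrightarrow> adj G x y"
proof
  assume "adj (graph_image f G) (f x) (f y)"
  then obtain e where e: "e \<in> snd G" "f ` e = {f x, f y}"
    by (auto simp: adj_def graph_image_def)
  moreover have "e \<subseteq> fst G" using e assms by (auto simp: edges_within_def)
  moreover have "f ` e = f ` {x, y}" using e by simp
  ultimately have "e = {x, y}"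
    using assms inj_on_image_eq_iff[of f "fst G" e "{x, y}"] by simp
  then show "adj G x y" using e by (simp add: adj_def)
next
  assume "adj G x y"
  then have "f ` {x, y} \<in> (`) f ` snd G" unfolding adj_def by (rule imageI)
  then show "adj (graph_image f G) (f x) (f y)" by (simp add: adj_def graph_image_def)
qed

text \<open>Carries the distance certificate over to the copy, so that all numbers attached to a
  petal can be computed once, in the gadget.\<close>

lemma level_graph_image:
  assumes "inj_on f (fst G)" "edges_within G" "connected_graph G" "u \<in> fst G"
  shows "level (graph_image f G) (f u) (\<lambda>y. gdist G u (inv_into (fst G) f y))"
proof -
  have V: "fst (graph_image f G) = f ` fst G" by (simp add: graph_image_def)
  show ?thesis
    unfolding level_def V
    using assms(4) gdist_self[OF assms(3,4)] gdist_step[OF assms(3,4)]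
    apply (auto simp: assms adj_graph_image[OF assms(1,2)] inv_into_f_f[OF assms(1)])
    by (metis assms(3,4) gdist_pred Suc_eq_plus1)
qed

lemma connected_graph_image:
  assumes "inj_on f (fst G)" "edges_within G" "connected_graph G" "fst G \<noteq> {}"
  shows "connected_graph (graph_image f G)"
proof -
  obtain u where "u \<in> fst G" using assms(4) by blast
  from level_connected[OF level_graph_image[OF assms(1-3) this]] show ?thesis .
qed

lemma trans_sum_graph_image:
  assumes "inj_on f (fst G)" "edges_within G" "connected_graph G" "u \<in> fst G"
  shows "trans_sum (graph_image f G) (f u) = trans_sum G u"
proof -
  have V: "fst (graph_image f G) = f ` fst G" by (simp add: graph_image_def)
  show ?thesis
    unfolding trans_sum_def V sum.reindex[OF assms(1)] o_def
    by (intro sum.cong refl)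
      (simp add: level_gdist[OF level_graph_image[OF assms]] V inv_into_f_f[OF assms(1)])
qed

lemma dist_sum_graph_image:
  assumes "inj_on f (fst G)" "edges_within G" "connected_graph G"
  shows "dist_sum (graph_image f G) = dist_sum G"
proof -
  have V: "fst (graph_image f G) = f ` fst G" by (simp add: graph_image_def)
  show ?thesis
    unfolding dist_sum_def V sum.reindex[OF assms(1)] o_def
    by (intro sum.cong refl) (simp add: trans_sum_graph_image[OF assms])
qed

lemma delete_vertex_graph_image:
  assumes "inj_on f (fst G)" "edges_within G" "v \<in> fst G"
  shows "delete_vertex (graph_image f G) (f v) = graph_image f (delete_vertex G v)"
proof -
  have "f v \<in> f ` e \<longleftrightarrow> v \<in> e" if "e \<in> snd G" for e
    using assms that by (meson edges_within_def inj_on_image_mem_iff)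
  then have "{e \<in> (`) f ` snd G. f v \<notin> e} = (`) f ` {e \<in> snd G. v \<notin> e}" by auto
  moreover have "f ` fst G - {f v} = f ` (fst G - {v})"
    using assms by (auto simp: inj_on_def)
  ultimately show ?thesis by (simp add: delete_vertex_def graph_image_def)
qed

section \<open>Leaves and their neighbours are never good\<close>

definition pendant :: "'a graph \<Rightarrow> 'a \<Rightarrow> 'a \<Rightarrow> bool" where
  "pendant G l p \<longleftrightarrow> l \<in> fst G \<and> p \<in> fst G \<and> p \<noteq> l \<and> (\<forall>e\<in>snd G. l \<in> e \<longrightarrow> e = {l, p})"

text \<open>No shortest path between two other vertices uses the leaf, so their distances survive
  its deletion, while the positive distances from the leaf itself are lost.\<close>

lemma pendant_not_good:
  assumes G: "finite (fst G)" "connected_graph G" and l: "pendant G l p"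
  shows "\<not> good_vertex G l"
proof -
  let ?D = "delete_vertex G l"
  have lp: "l \<in> fst G" "p \<in> fst G" "p \<noteq> l" "\<And>w. adj G l w \<Longrightarrow> w = p"
    using l by (auto simp: pendant_def adj_def doubleton_eq_iff)
  have lev: "level ?D u (gdist G u)" if u: "u \<in> fst ?D" for u
    unfolding level_def
  proof (intro conjI ballI impI)
    have u': "u \<in> fst G" "u \<noteq> l" using u by auto
    show "gdist G u u = 0" using gdist_self[OF G(2) u'(1)] .
    show "gdist G u y \<le> gdist G u x + 1" if "x \<in> fst ?D" "y \<in> fst ?D" "adj ?D x y" for x y
      using gdist_step[OF G(2) u'(1)] that by (auto simp: adj_def delete_vertex_def)
    fix v assume v: "v \<in> fst ?D" "v \<noteq> u"
    then have v': "v \<in> fst G" "v \<noteq> l" by auto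
    from gdist_pred[OF G(2) u'(1) v'(1) v(2)] obtain w where
      w: "w \<in> fst G" "adj G w v" "gdist G u v = gdist G u w + 1" .
    \<comment> \<open>If the predecessor were the leaf, then \<open>v\<close> would be
      \<open>p\<close>; but the predecessor of the leaf is \<open>p\<close> as well, so
      \<open>p\<close> would be at distance two more than itself.\<close>
    have "w \<noteq> l"
    proof
      assume "w = l"
      then have vp: "v = p" using lp(4) w by blast
      from gdist_pred[OF G(2) u'(1) lp(1)] u'(2) obtain z where
        z: "adj G z l" "gdist G u l = gdist G u z + 1" by metis
      then have "z = p" using lp(4) adj_sym by metis
      then show False using z w vp \<open>w = l\<close> by simp
    qed
    then show "\<exists>w\<in>fst ?D. adj ?D w v \<and> gdist G u v = gdist G u w + 1"
      using w v' by (intro bexI[of _ w]) (auto simp: adj_def delete_vertex_def)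
  qed (fact u)
  have conn: "connected_graph ?D" using lev[of p] lp by (intro level_connected) auto
  have "dist_sum ?D = (\<Sum>u\<in>fst G - {l}. \<Sum>v\<in>fst G - {l}. gdist G u v)"
    unfolding dist_sum_def trans_sum_def fst_delete_vertex
    by (intro sum.cong refl level_gdist[OF lev]) auto
  also have "\<dots> \<le> (\<Sum>u\<in>fst G - {l}. trans_sum G u)"
    unfolding trans_sum_def using G by (intro sum_mono sum_mono2) auto
  also have "\<dots> < trans_sum G l + (\<Sum>u\<in>fst G - {l}. trans_sum G u)"
  proof -
    obtain z where "gdist G l p = gdist G l z + 1" using gdist_pred[OF G(2) lp(1,2,3)] .
    then have "gdist G l p > 0" by simp
    also have "gdist G l p \<le> trans_sum G l"
      unfolding trans_sum_def using G lp by (intro member_le_sum) auto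
    finally show ?thesis by simp
  qed
  also have "\<dots> = dist_sum G"
    unfolding dist_sum_def using G lp by (simp add: sum.remove[of _ l])
  finally have "dist_sum ?D \<noteq> dist_sum G" by simp
  moreover have "finite (fst ?D)" using G by simp
  ultimately show ?thesis
    using wiener_eq_iff[OF G _ conn] unfolding good_vertex_def by metis
qed

text \<open>Deleting \<open>p\<close> isolates the leaf from the third vertex \<open>w\<close>, so
  the Wiener index becomes infinite.\<close>

lemma pendant_neighbour_not_good:
  assumes G: "finite (fst G)" "connected_graph G" and l: "pendant G l p"
    and w: "w \<in> fst G" "w \<noteq> l" "w \<noteq> p"
  shows "\<not> good_vertex G p"
proof -
  let ?D = "delete_vertex G p"
  have no_edge: "\<not> adj ?D x y" if "x = l \<or> y = l" for x y
    using l that by (auto simp: pendant_def adj_def delete_vertex_def)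
  have "\<not> connected_graph ?D"
  proof
    assume "connected_graph ?D"
    moreover have "l \<in> fst ?D" "w \<in> fst ?D" using w l by (auto simp: pendant_def)
    ultimately obtain xs where xs: "walk ?D xs" "hd xs = l" "last xs = w"
      unfolding connected_graph_def by blast
    \<comment> \<open>No edge touches \<open>l\<close> any more, so this jump function satisfies the
      growth bound vacuously at \<open>l\<close>; a walk from \<open>l\<close> to \<open>w\<close>
      would then have to be longer than it is.\<close>
    let ?f = "\<lambda>x. if x = l then 0 else length xs"
    have "?f (last xs) + 1 \<le> ?f (hd xs) + length xs"
      using no_edge by (intro walk_lipschitz[OF xs(1)]) auto
    then show False using xs w by simp
  qed
  then have "wiener ?D = \<infinity>" by (simp add: wiener_def)
  then show ?thesis using wiener_dist_sum[OF G] by (auto simp: good_vertex_def)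
qed

subsection \<open>The gadget\<close>

definition list_graph :: "'a list \<Rightarrow> ('a \<times> 'a) list \<Rightarrow> 'a graph" where
  "list_graph vs es = (set vs, (\<lambda>(x, y). {x, y}) ` set es)"

text \<open>Executable form of \<open>level\<close> for all sources at once. An edge is listed in
  one orientation only, hence the symmetric conditions; \<open>distinct\<close> allows sums over
  sets to be computed as sums over lists.\<close>

definition dist_check :: "'a list \<Rightarrow> ('a \<times> 'a) list \<Rightarrow> ('a \<Rightarrow> 'a \<Rightarrow> nat) \<Rightarrow> bool" where
  "dist_check vs es d \<longleftrightarrow> distinct vs \<and> vs \<noteq> [] \<and>
     list_all (\<lambda>u. d u u = 0 \<and>
       list_all (\<lambda>(x, y). d u y \<le> d u x + 1 \<and> d u x \<le> d u y + 1) es \<and>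
       list_all (\<lambda>v. v = u \<or> list_ex (\<lambda>(x, y). (y = v \<and> d u v = d u x + 1) \<or>
         (x = v \<and> d u v = d u y + 1)) es) vs) vs"

lemma edges_within_list_graph:
  assumes "list_all (\<lambda>(x, y). x \<in> set vs \<and> y \<in> set vs) es"
  shows "edges_within (list_graph vs es)"
  using assms by (auto simp: edges_within_def list_graph_def list_all_iff)

lemma delete_vertex_list_graph:
  "delete_vertex (list_graph vs es) v =
    list_graph (filter (\<lambda>x. x \<noteq> v) vs) (filter (\<lambda>(x, y). x \<noteq> v \<and> y \<noteq> v) es)"
  by (auto simp: delete_vertex_def list_graph_def)

lemma adj_list_graph:
  "adj (list_graph vs es) x y \<longleftrightarrow> (x, y) \<in> set es \<or> (y, x) \<in> set es"
  by (auto simp: adj_def list_graph_def doubleton_eq_iff)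

lemma level_list_graph:
  assumes "dist_check vs es d" "list_all (\<lambda>(x, y). x \<in> set vs \<and> y \<in> set vs) es" "u \<in> set vs"
  shows "level (list_graph vs es) u (d u)"
  unfolding level_def
proof (intro conjI ballI impI)
  have V: "fst (list_graph vs es) = set vs" by (simp add: list_graph_def)
  show "u \<in> fst (list_graph vs es)" using assms(3) V by simp
  have c: "d u u = 0"
    "\<And>x y. (x, y) \<in> set es \<Longrightarrow> d u y \<le> d u x + 1 \<and> d u x \<le> d u y + 1"
    "\<And>v. v \<in> set vs \<Longrightarrow> v = u \<or> (\<exists>(x, y)\<in>set es. (y = v \<and> d u v = d u x + 1) \<or>
         (x = v \<and> d u v = d u y + 1))"
    using assms(1,3) by (auto simp: dist_check_def list_all_iff list_ex_iff)
  show "d u u = 0" by (rule c)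
  show "d u y \<le> d u x + 1" if "adj (list_graph vs es) x y" for x y
    using that c(2) by (auto simp: adj_list_graph)
  fix v assume "v \<in> fst (list_graph vs es)" "v \<noteq> u"
  then obtain x y where xy: "(x, y) \<in> set es"
    "(y = v \<and> d u v = d u x + 1) \<or> (x = v \<and> d u v = d u y + 1)"
    using c(3)[of v] V by auto
  then have "x \<in> set vs" "y \<in> set vs" using assms(2) by (auto simp: list_all_iff)
  then show "\<exists>w\<in>fst (list_graph vs es). adj (list_graph vs es) w v \<and> d u v = d u w + 1"
    using xy V by (auto simp: adj_list_graph)
qed

lemma dist_check_sound:
  assumes "dist_check vs es d" "list_all (\<lambda>(x, y). x \<in> set vs \<and> y \<in> set vs) es"
  shows "connected_graph (list_graph vs es)"
    and "u \<in> set vs \<Longrightarrow> trans_sum (list_graph vs es) u = sum_list (map (d u) vs)"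
    and "dist_sum (list_graph vs es) = sum_list (map (\<lambda>u. sum_list (map (d u) vs)) vs)"
proof -
  have V: "fst (list_graph vs es) = set vs" by (simp add: list_graph_def)
  have dist: "distinct vs" "vs \<noteq> []" using assms by (auto simp: dist_check_def)
  note lev = level_list_graph[OF assms]
  show "connected_graph (list_graph vs es)" using lev[of "hd vs"] dist by (auto intro: level_connected)
  have t: "trans_sum (list_graph vs es) u = sum_list (map (d u) vs)" if u: "u \<in> set vs" for u
  proof -
    have "trans_sum (list_graph vs es) u = (\<Sum>v\<in>set vs. d u v)"
      unfolding trans_sum_def V using V by (intro sum.cong refl level_gdist[OF lev[OF u]]) simp
    then show ?thesis using dist by (simp add: sum_list_distinct_conv_sum_set)
  qed
  then show "u \<in> set vs \<Longrightarrow> trans_sum (list_graph vs es) u = sum_list (map (d u) vs)" .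
  have "dist_sum (list_graph vs es) = (\<Sum>u\<in>set vs. sum_list (map (d u) vs))"
    unfolding dist_sum_def V using t by (intro sum.cong refl)
  then show "dist_sum (list_graph vs es) = sum_list (map (\<lambda>u. sum_list (map (d u) vs)) vs)"
    using dist by (simp add: sum_list_distinct_conv_sum_set)
qed

text \<open>The cycle \<open>0, \<dots>, c - 1\<close> with leaves \<open>c, \<dots>, gadget_top c\<close> at 2: vertex 0 is the gluing
  vertex and vertex 1 is going to be good.\<close>

definition gadget_top :: "nat \<Rightarrow> nat" where
  "gadget_top c = (if c = 5 then 7 else 6)"

definition gadget_verts :: "nat \<Rightarrow> nat list" where
  "gadget_verts c = [0..<gadget_top c + 1]"

definition gadget_edges :: "nat \<Rightarrow> (nat \<times> nat) list" where
  "gadget_edges c = map (\<lambda>j. (j, (j + 1) mod c)) [0..<c] @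
     map (\<lambda>j. (2, j)) [c..<gadget_top c + 1]"

definition gadget :: "nat \<Rightarrow> nat graph" where
  "gadget c = list_graph (gadget_verts c) (gadget_edges c)"

text \<open>Distances in the gadget, and in the tree left after deleting a cycle vertex \<open>v\<close>. Leaves
  are projected to their neighbour 2 and contribute one extra step.\<close>

definition leaf_offset :: "nat \<Rightarrow> nat \<Rightarrow> nat" where
  "leaf_offset c x = (if x < c then 0 else 1)"

definition cycle_pos :: "nat \<Rightarrow> nat \<Rightarrow> nat" where
  "cycle_pos c x = (if x < c then x else 2)"

definition line_dist :: "nat \<Rightarrow> nat \<Rightarrow> nat" where
  "line_dist a b = (a - b) + (b - a)"

definition cycle_dist :: "nat \<Rightarrow> nat \<Rightarrow> nat \<Rightarrow> nat" where
  "cycle_dist c x y = (if x = y then 0 else leaf_offset c x + leaf_offset c y +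
     (let \<delta> = line_dist (cycle_pos c x) (cycle_pos c y) in min \<delta> (c - \<delta>)))"

text \<open>Rotating by \<open>c - v - 1\<close> moves the deleted vertex \<open>v\<close> to
  position \<open>c - 1\<close>, so the remaining cycle vertices form the path 0, ..., c -
  2.\<close>

definition cut_dist :: "nat \<Rightarrow> nat \<Rightarrow> nat \<Rightarrow> nat \<Rightarrow> nat" where
  "cut_dist c v x y = (if x = y then 0 else leaf_offset c x + leaf_offset c y +
     line_dist ((cycle_pos c x + (c - v - 1)) mod c) ((cycle_pos c y + (c - v - 1)) mod c))"

lemma gadget_check:
  "list_all (\<lambda>c. dist_check (gadget_verts c) (gadget_edges c) (cycle_dist c) \<and>
     list_all (\<lambda>(x, y). x \<in> set (gadget_verts c) \<and> y \<in> set (gadget_verts c)) (gadget_edges c) \<and>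
     sum_list (map (cycle_dist c 0) (gadget_verts c)) = 3 * gadget_top c - 6) [5, 6]"
  by code_simp

text \<open>Vertices 0 and 2 are left out: one is the root, the other a neighbour of leaves.
  Deleting 1 moves vertex 2 away from the root by one step if c = 5 and by two if c = 6. With three
  leaves at 2 in the first case and one in the second, the total increase is 4; losing vertex 1
  itself takes off 1, which gives the 3. The distance sum drops by 16 or 14, that is, by 26 - 2c.
  For the other vertices, crude common bounds are enough.\<close>

lemma gadget_delete_check:
  "list_all (\<lambda>c. list_all (\<lambda>v. 
     let vs = filter (\<lambda>x. x \<noteq> v) (gadget_verts c);
         es = filter (\<lambda>(x, y). x \<noteq> v \<and> y \<noteq> v) (gadget_edges c);
         d = cycle_dist c; d' = cut_dist c v;
         w = sum_list (map (\<lambda>u. sum_list (map (d u) (gadget_verts c))) (gadget_verts c));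
         w' = sum_list (map (\<lambda>u. sum_list (map (d' u) vs)) vs);
         t = sum_list (map (d 0) (gadget_verts c));
         t' = sum_list (map (d' 0) vs)
     in dist_check vs es d' \<and> list_all (\<lambda>(x, y). x \<in> set vs \<and> y \<in> set vs) es \<and>
       (if v = 1 then w' + 26 = w + 2 * c \<and> t' = t + 3 else w' \<le> w + 10 \<and> t' \<le> t + 1))
     (1 # [3..<c])) [5, 6]"
  by code_simp

lemma gadget_values:
  assumes "c \<in> {5, 6}"
  shows "connected_graph (gadget c)" "edges_within (gadget c)"
    "trans_sum (gadget c) 0 = 3 * gadget_top c - 6"
proof -
  have c: "dist_check (gadget_verts c) (gadget_edges c) (cycle_dist c)"
    "list_all (\<lambda>(x, y). x \<in> set (gadget_verts c) \<and> y \<in> set (gadget_verts c)) (gadget_edges c)"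
    "sum_list (map (cycle_dist c 0) (gadget_verts c)) = 3 * gadget_top c - 6"
    using assms gadget_check unfolding list.pred_inject by blast+
  show "connected_graph (gadget c)" "edges_within (gadget c)"
    unfolding gadget_def using dist_check_sound(1)[OF c(1,2)] edges_within_list_graph[OF c(2)] .
  show "trans_sum (gadget c) 0 = 3 * gadget_top c - 6"
    unfolding gadget_def c(3)[symmetric]
    by (rule dist_check_sound(2)[OF c(1,2)]) (auto simp: gadget_verts_def)
qed

lemma gadget_delete_values:
  assumes "c \<in> {5, 6}" "v = 1 \<or> v \<in> {3..<c}"
  shows "connected_graph (delete_vertex (gadget c) v)"
    "v = 1 \<Longrightarrow> dist_sum (delete_vertex (gadget c) v) + 26 = dist_sum (gadget c) + 2 * c"
    "v = 1 \<Longrightarrow> trans_sum (delete_vertex (gadget c) v) 0 = trans_sum (gadget c) 0 + 3"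
    "v \<noteq> 1 \<Longrightarrow> dist_sum (delete_vertex (gadget c) v) \<le> dist_sum (gadget c) + 10"
    "v \<noteq> 1 \<Longrightarrow> trans_sum (delete_vertex (gadget c) v) 0 \<le> trans_sum (gadget c) 0 + 1"
proof -
  define vs where "vs = filter (\<lambda>x. x \<noteq> v) (gadget_verts c)"
  define es where "es = filter (\<lambda>(x, y). x \<noteq> v \<and> y \<noteq> v) (gadget_edges c)"
  have c: "dist_check (gadget_verts c) (gadget_edges c) (cycle_dist c)"
    "list_all (\<lambda>(x, y). x \<in> set (gadget_verts c) \<and> y \<in> set (gadget_verts c)) (gadget_edges c)"
    using assms(1) gadget_check unfolding list.pred_inject by blast+
  have d: "delete_vertex (gadget c) v = list_graph vs es"
    unfolding gadget_def delete_vertex_list_graph vs_def es_def ..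
  have "v \<in> set (1 # [3..<c])" "c \<in> set [5, 6]" using assms by auto
  note e = gadget_delete_check[unfolded list_all_iff Let_def, rule_format, OF this(2,1),
    folded vs_def es_def list_all_iff]
  then have e1: "dist_check vs es (cut_dist c v)"
    "list_all (\<lambda>(x, y). x \<in> set vs \<and> y \<in> set vs) es" by (auto simp: list_all_iff)
  have z: "0 \<in> set (gadget_verts c)" "0 \<in> set vs"
    using assms by (auto simp: vs_def gadget_verts_def)
  show "connected_graph (delete_vertex (gadget c) v)"
    unfolding d by (rule dist_check_sound(1)[OF e1])
  show "v = 1 \<Longrightarrow> dist_sum (delete_vertex (gadget c) v) + 26 = dist_sum (gadget c) + 2 * c"
    "v = 1 \<Longrightarrow> trans_sum (delete_vertex (gadget c) v) 0 = trans_sum (gadget c) 0 + 3"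
    "v \<noteq> 1 \<Longrightarrow> dist_sum (delete_vertex (gadget c) v) \<le> dist_sum (gadget c) + 10"
    "v \<noteq> 1 \<Longrightarrow> trans_sum (delete_vertex (gadget c) v) 0 \<le> trans_sum (gadget c) 0 + 1"
    unfolding d unfolding gadget_def dist_check_sound(3)[OF e1] dist_check_sound(3)[OF c]
      dist_check_sound(2)[OF e1 z(2)] dist_check_sound(2)[OF c z(1)]
    using e by auto
qed

subsection \<open>The flower-like cactus graphs\<close>

lemma simple_graph_iff:
  "simple_graph G \<longleftrightarrow> finite (fst G) \<and> (\<forall>e\<in>snd G. card e = 2 \<and> e \<subseteq> fst G)"
proof -
  have "(\<exists>u v. u \<noteq> v \<and> e = {u, v} \<and> u \<in> V \<and> v \<in> V) \<longleftrightarrow> card e = 2 \<and> e \<subseteq> V" for e V :: "'a set"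
    by (auto simp: card_2_iff)
  then show ?thesis unfolding simple_graph_def by simp
qed

lemma simple_graph_glue: "simple_graph A \<Longrightarrow> simple_graph B \<Longrightarrow> simple_graph (glue A B)"
  unfolding simple_graph_iff glue_def by auto

lemma simple_graph_image:
  assumes "simple_graph G" "inj_on f (fst G)"
  shows "simple_graph (graph_image f G)"
proof -
  have "card (f ` e) = 2 \<and> f ` e \<subseteq> f ` fst G" if "e \<in> snd G" for e
  proof -
    have "card e = 2" "e \<subseteq> fst G" using assms(1) that by (auto simp: simple_graph_iff)
    then show ?thesis using assms(2) by (simp add: card_image inj_on_subset image_mono)
  qed
  then show ?thesis using assms(1) by (simp add: simple_graph_iff graph_image_def)
qed

lemma fst_gadget: "fst (gadget c) = {..gadget_top c}"
  by (auto simp: gadget_def list_graph_def gadget_verts_def)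

lemma snd_gadget: "snd (gadget c) = (\<lambda>j. {j, (j + 1) mod c}) ` {..<c} \<union>
    (\<lambda>j. {2, j}) ` {c..gadget_top c}"
proof -
  have "set [0..<c] = {..<c}" "set [c..<gadget_top c + 1] = {c..gadget_top c}" by auto
  then show ?thesis
    by (simp add: gadget_def list_graph_def gadget_edges_def image_Un image_image
        del: set_upt upt.simps)
qed

lemma gadget_top_ge: "c \<in> {5, 6} \<Longrightarrow> c \<le> gadget_top c"
  by (auto simp: gadget_top_def)

lemma simple_graph_gadget:
  assumes "c \<in> {5, 6}"
  shows "simple_graph (gadget c)"
  unfolding simple_graph_iff
proof (intro conjI ballI)
  fix e assume "e \<in> snd (gadget c)"
  then consider j where "j < c" "e = {j, (j + 1) mod c}" | j where "j \<in> {c..gadget_top c}" "e = {2, j}"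
    by (auto simp: snd_gadget)
  then have "card e = 2 \<and> e \<subseteq> fst (gadget c)"
  proof cases
    case 1
    have "(j + 1) mod c < c" using assms by auto
    then have "(j + 1) mod c \<le> gadget_top c" "j \<le> gadget_top c"
      using gadget_top_ge[OF assms] 1(1) by linarith+
    moreover have "j \<noteq> (j + 1) mod c" using assms 1(1) by (auto simp: mod_Suc)
    ultimately show ?thesis by (simp add: 1(2) fst_gadget card_insert_if)
  next
    case 2
    then show ?thesis using assms by (auto simp: fst_gadget card_insert_if)
  qed
  then show "card e = 2" "e \<subseteq> fst (gadget c)" by auto
qed (simp add: fst_gadget)

section \<open>Vertex codes, the caterpillar and the bouquet\<close>

definition spine :: "nat \<Rightarrow> nat" where
  "spine s = prod_encode (0, s)"

definition leaf :: "nat \<Rightarrow> nat \<Rightarrow> nat" where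
  "leaf s m = prod_encode (1, prod_encode (s, m))"

text \<open>Vertices are natural numbers tagged 0, 1 or 2. Index 0 of every petal is the root
  \<open>spine 0\<close>, so distinct petals share exactly this vertex.\<close>

definition petal :: "nat \<Rightarrow> nat \<Rightarrow> nat" where
  "petal i j = (if j = 0 then spine 0 else prod_encode (2, prod_encode (i, j)))"

lemma vertex_eq [simp]:
  "spine s = spine s' \<longleftrightarrow> s = s'"
  "leaf s m = leaf s' m' \<longleftrightarrow> s = s' \<and> m = m'"
  "petal i j = petal i' j' \<longleftrightarrow> j = j' \<and> (j = 0 \<or> i = i')"
  "petal i j = spine s \<longleftrightarrow> j = 0 \<and> s = 0"
  "spine s = petal i j \<longleftrightarrow> j = 0 \<and> s = 0"
  "spine s \<noteq> leaf s' m" "leaf s' m \<noteq> spine s"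
  "petal i j \<noteq> leaf s m" "leaf s m \<noteq> petal i j"
  by (auto simp: spine_def leaf_def petal_def)

lemma inj_petal: "inj_on (petal i) A"
  by (auto simp: inj_on_def)

definition caterpillar :: "(nat \<Rightarrow> nat) \<Rightarrow> nat graph" where
  "caterpillar L = (spine ` {..<4} \<union> (\<lambda>(s, m). leaf s m) ` (SIGMA s:{..<4}. {..<L s}),
     (\<lambda>s. {spine s, spine (s + 1)}) ` {..<3} \<union>
     (\<lambda>(s, m). {spine s, leaf s m}) ` (SIGMA s:{..<4}. {..<L s}))"

text \<open>Indexing the petals by a set lets any chosen petal be treated as the last one glued
  on.\<close>

definition bouquet :: "nat \<Rightarrow> (nat \<Rightarrow> nat) \<Rightarrow> nat set \<Rightarrow> nat graph" where
  "bouquet c L I = (fst (caterpillar L) \<union> (\<Union>i\<in>I. fst (graph_image (petal i) (gadget c))),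
     snd (caterpillar L) \<union> (\<Union>i\<in>I. snd (graph_image (petal i) (gadget c))))"

lemma bouquet_empty: "bouquet c L {} = caterpillar L"
  by (simp add: bouquet_def)

lemma bouquet_insert:
  "bouquet c L (insert i I) = glue (bouquet c L I) (graph_image (petal i) (gadget c))"
  by (auto simp: bouquet_def glue_def)

lemma simple_graph_caterpillar: "simple_graph (caterpillar L)"
  unfolding simple_graph_iff by (auto simp: caterpillar_def)

text \<open>The distance from the root in the caterpillar, read off the vertex code.\<close>

definition depth :: "nat \<Rightarrow> nat" where
  "depth x = (case prod_decode x of (a, b) \<Rightarrow> if a = 0 then b else fst (prod_decode b) + 1)"

lemma depth_simps [simp]: "depth (spine s) = s" "depth (leaf s m) = s + 1"
  by (simp_all add: depth_def spine_def leaf_def)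

lemma level_caterpillar: "level (caterpillar L) (spine 0) depth"
  unfolding level_def
proof (intro conjI ballI impI)
  show "spine 0 \<in> fst (caterpillar L)" by (simp add: caterpillar_def)
  show "depth y \<le> depth x + 1" if "adj (caterpillar L) x y" for x y
    using that by (auto simp: adj_def caterpillar_def doubleton_eq_iff)
  fix v assume v: "v \<in> fst (caterpillar L)" "v \<noteq> spine 0"
  from v consider s where "s < 4" "s \<noteq> 0" "v = spine s"
    | s m where "s < 4" "m < L s" "v = leaf s m"
    by (auto simp: caterpillar_def)
  then show "\<exists>w\<in>fst (caterpillar L). adj (caterpillar L) w v \<and> depth v = depth w + 1"
  proof cases
    case 1
    then obtain s' where "s = s' + 1" by (cases s) auto
    then show ?thesis using 1
      by (intro bexI[of _ "spine s'"]) (auto simp: caterpillar_def adj_def)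
  next
    case 2
    then show ?thesis
      by (intro bexI[of _ "spine s"]) (auto simp: caterpillar_def adj_def)
  qed
qed simp

lemma card_caterpillar: "card (fst (caterpillar L)) = 4 + (\<Sum>s<4. L s)"
proof -
  have "card (spine ` {..<4}) = 4" by (subst card_image) (auto simp: inj_on_def)
  moreover have "card ((\<lambda>(s, m). leaf s m) ` (SIGMA s:{..<4}. {..<L s})) = (\<Sum>s<4. L s)"
    by (subst card_image) (auto simp: inj_on_def)
  ultimately show ?thesis
    unfolding caterpillar_def fst_conv by (subst card_Un_disjoint) auto
qed

lemma trans_sum_caterpillar:
  "trans_sum (caterpillar L) (spine 0) = 6 + (\<Sum>s<4. (s + 1) * L s)"
proof -
  have "trans_sum (caterpillar L) (spine 0) = (\<Sum>x\<in>fst (caterpillar L). depth x)"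
    unfolding trans_sum_def by (intro sum.cong refl level_gdist[OF level_caterpillar])
  also have "\<dots> = (\<Sum>x\<in>spine ` {..<4}. depth x) +
      (\<Sum>x\<in>(\<lambda>(s, m). leaf s m) ` (SIGMA s:{..<4}. {..<L s}). depth x)"
    unfolding caterpillar_def fst_conv by (intro sum.union_disjoint) auto
  also have "(\<Sum>x\<in>spine ` {..<4}. depth x) = (\<Sum>s<4. s)"
    by (subst sum.reindex) (auto simp: inj_on_def)
  also have "(\<Sum>x\<in>(\<lambda>(s, m). leaf s m) ` (SIGMA s:{..<4}. {..<L s}). depth x) =
      (\<Sum>(s, m)\<in>(SIGMA s:{..<4}. {..<L s}). s + 1)"
    by (subst sum.reindex) (auto simp: inj_on_def split_def)
  also have "\<dots> = (\<Sum>s<4. (s + 1) * L s)"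
    by (subst sum.Sigma[symmetric]) (auto simp: mult.commute)
  finally show ?thesis by (simp add: eval_nat_numeral)
qed

lemma petal_inter_bouquet:
  assumes "i \<notin> I"
  shows "fst (bouquet c L I) \<inter> fst (graph_image (petal i) (gadget c)) = {spine 0}"
proof -
  have "spine 0 = petal i 0" by simp
  then have "spine 0 \<in> fst (graph_image (petal i) (gadget c))"
    unfolding graph_image_def fst_conv fst_gadget by blast
  moreover have "spine 0 \<in> fst (bouquet c L I)" by (simp add: bouquet_def caterpillar_def)
  moreover have "x = spine 0" if "x \<in> fst (bouquet c L I)" "x = petal i j" for x j
    using that assms by (auto simp: bouquet_def caterpillar_def graph_image_def)
  ultimately show ?thesis unfolding graph_image_def fst_conv by blast
qed

lemma petal_gadget:
  assumes "c \<in> {5, 6}"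
  shows "connected_graph (graph_image (petal i) (gadget c))"
    "edges_within (graph_image (petal i) (gadget c))"
    "finite (fst (graph_image (petal i) (gadget c)))"
    "card (fst (graph_image (petal i) (gadget c))) = Suc (gadget_top c)"
    "trans_sum (graph_image (petal i) (gadget c)) (spine 0) = 3 * gadget_top c - 6"
proof -
  note g = gadget_values[OF assms]
  show "connected_graph (graph_image (petal i) (gadget c))"
    by (intro connected_graph_image g inj_petal) (simp add: fst_gadget)
  show "edges_within (graph_image (petal i) (gadget c))" by (intro edges_within_image g)
  show "finite (fst (graph_image (petal i) (gadget c)))" by (simp add: graph_image_def fst_gadget)
  show "card (fst (graph_image (petal i) (gadget c))) = Suc (gadget_top c)"
    by (simp add: graph_image_def fst_gadget card_image inj_petal)
  have "trans_sum (graph_image (petal i) (gadget c)) (petal i 0) = 3 * gadget_top c - 6"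
    unfolding g(3)[symmetric]
    by (intro trans_sum_graph_image g inj_petal) (simp add: fst_gadget)
  then show "trans_sum (graph_image (petal i) (gadget c)) (spine 0) = 3 * gadget_top c - 6"
    by (simp add: petal_def)
qed

text \<open>Petals are glued one at a time. Seen from the root, the cross term in
  \<open>trans_sum_glue\<close> vanishes, so root transmissions simply add up.\<close>

lemma bouquet_values:
  assumes "c \<in> {5, 6}" "finite I"
  shows "simple_graph (bouquet c L I) \<and> connected_graph (bouquet c L I) \<and>
    card (fst (bouquet c L I)) = 4 + (\<Sum>s<4. L s) + card I * gadget_top c \<and>
    trans_sum (bouquet c L I) (spine 0) =
      6 + (\<Sum>s<4. (s + 1) * L s) + card I * (3 * gadget_top c - 6)"
  using assms(2)
proof (induction I rule: finite_induct)
  case empty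
  show ?case
    using level_connected[OF level_caterpillar]
    by (simp add: bouquet_empty simple_graph_caterpillar card_caterpillar trans_sum_caterpillar)
next
  case (insert i I)
  let ?A = "bouquet c L I" and ?B = "graph_image (petal i) (gadget c)"
  note B = petal_gadget[OF assms(1), of i]
  have A: "connected_graph ?A" "edges_within ?A" "finite (fst ?A)"
    using insert.IH simple_graph_edges_within[of ?A] by (auto simp: simple_graph_def)
  note AB = petal_inter_bouquet[OF insert.hyps(2), of c L]
  have r: "spine 0 \<in> fst ?A" using AB by auto
  have "simple_graph (glue ?A ?B)"
    using insert.IH by (intro simple_graph_glue simple_graph_image simple_graph_gadget assms inj_petal) simp
  moreover have "connected_graph (glue ?A ?B)"
    by (rule connected_glue[OF A(1) B(1) A(2) B(2) AB])
  moreover have "card (fst (glue ?A ?B)) = card (fst ?A) + gadget_top c"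
    using card_Un_Int[OF A(3) B(3)] B(4) AB by (simp add: glue_def)
  moreover have "trans_sum (glue ?A ?B) (spine 0) = trans_sum ?A (spine 0) + trans_sum ?B (spine 0)"
    using trans_sum_glue[OF A(1) B(1) A(2) B(2) AB A(3) B(3) B(4) r] gdist_self[OF A(1) r] by simp
  ultimately show ?case
    unfolding bouquet_insert using insert B(5) by simp
qed

section \<open>Edges, vertices and leaves of a bouquet\<close>

lemma bouquet_edge_iff:
  "e \<in> snd (bouquet c L I) \<longleftrightarrow>
    (\<exists>s<3. e = {spine s, spine (s + 1)}) \<or>
    (\<exists>s<4. \<exists>m<L s. e = {spine s, leaf s m}) \<or>
    (\<exists>i\<in>I. \<exists>j<c. e = {petal i j, petal i ((j + 1) mod c)}) \<or>
    (\<exists>i\<in>I. \<exists>j\<in>{c..gadget_top c}. e = {petal i 2, petal i j})"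
proof -
  have petals: "e \<in> snd (graph_image (petal i) (gadget c)) \<longleftrightarrow>
      (\<exists>j<c. e = {petal i j, petal i ((j + 1) mod c)}) \<or>
      (\<exists>j\<in>{c..gadget_top c}. e = {petal i 2, petal i j})" for i
  proof -
    have "snd (graph_image (petal i) (gadget c)) =
        (\<lambda>j. {petal i j, petal i ((j + 1) mod c)}) ` {..<c} \<union>
        (\<lambda>j. {petal i 2, petal i j}) ` {c..gadget_top c}"
      by (simp add: graph_image_def snd_gadget image_Un image_image)
    then show ?thesis by (simp only: Un_iff image_iff Bex_def lessThan_iff)
  qed
  have spines: "e \<in> (\<lambda>s. {spine s, spine (s + 1)}) ` {..<3} \<longleftrightarrow>
      (\<exists>s<3. e = {spine s, spine (s + 1)})"
    by (simp only: image_iff Bex_def lessThan_iff)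
  have leaves: "e \<in> (\<lambda>(s, m). {spine s, leaf s m}) ` (SIGMA s:{..<4}. {..<L s}) \<longleftrightarrow>
      (\<exists>s<4. \<exists>m<L s. e = {spine s, leaf s m})"
    by (simp only: image_iff Bex_def split_paired_Ex mem_Sigma_iff lessThan_iff prod.case) blast
  show ?thesis
    unfolding bouquet_def caterpillar_def snd_conv Un_iff UN_iff petals spines leaves by blast
qed

lemma bouquet_vertex_cases:
  assumes "x \<in> fst (bouquet c L I)"
  obtains s where "s < 4" "x = spine s" | s m where "s < 4" "m < L s" "x = leaf s m"
    | i j where "i \<in> I" "0 < j" "j \<le> gadget_top c" "x = petal i j"
proof -
  from assms consider "x \<in> fst (caterpillar L)" | i j where "i \<in> I" "j \<le> gadget_top c" "x = petal i j"
    by (auto simp: bouquet_def graph_image_def fst_gadget)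
  then show thesis
  proof cases
    case 1
    then show ?thesis using that by (auto simp: caterpillar_def)
  next
    case 2
    then show ?thesis using that(1)[of 0] that(3)[of i j] by (cases "j = 0") (auto simp: petal_def)
  qed
qed

lemma bouquet_vertices:
  "s < 4 \<Longrightarrow> spine s \<in> fst (bouquet c L I)"
  "s < 4 \<Longrightarrow> m < L s \<Longrightarrow> leaf s m \<in> fst (bouquet c L I)"
  "i \<in> I \<Longrightarrow> j \<le> gadget_top c \<Longrightarrow> petal i j \<in> fst (bouquet c L I)"
  by (auto simp: bouquet_def caterpillar_def graph_image_def fst_gadget)

lemma pendant_leaf:
  assumes "s < 4" "m < L s"
  shows "pendant (bouquet c L I) (leaf s m) (spine s)"
  using assms by (auto simp: pendant_def bouquet_edge_iff bouquet_vertices)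

lemma pendant_petal:
  assumes "i \<in> I" "2 < c" "j \<in> {c..gadget_top c}"
  shows "pendant (bouquet c L I) (petal i j) (petal i 2)"
proof -
  \<comment> \<open>Residues modulo \<open>c\<close> are smaller than the index of a leaf, so no
    cycle edge touches a leaf.\<close>
  have n: "x mod c \<noteq> j" for x
  proof -
    have "x mod c < c" using assms(2) by simp
    moreover have "c \<le> j" using assms(3) by simp
    ultimately show ?thesis by linarith
  qed
  have "e = {petal i j, petal i 2}" if e: "e \<in> snd (bouquet c L I)" "petal i j \<in> e" for e
    using e(1)[unfolded bouquet_edge_iff]
  proof (elim disjE exE bexE conjE)
    fix i' j' assume "j' < c" "e = {petal i' j', petal i' ((j' + 1) mod c)}"
    then show ?thesis using e(2) n[of j'] n[of "j' + 1"] by auto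
  next
    fix i' j' assume "e = {petal i' 2, petal i' j'}"
    then show ?thesis using e(2) assms by auto
  qed (use e(2) assms in auto)
  then show ?thesis using assms by (simp add: pendant_def bouquet_vertices)
qed

subsection \<open>Their cycles\<close>

text \<open>At a position of the cycle the only edges lead to the next and to the previous position.
  Stated through the edge set alone, it spares later arguments the list of vertices.\<close>

lemma cycle_two_edges:
  assumes "is_cycle G C" "{x, a} \<in> C"
  obtains b where "b \<noteq> a" "\<And>y. {x, y} \<in> C \<longleftrightarrow> y = a \<or> y = b"
proof -
  from assms(1) obtain vs where vs: "length vs \<ge> 3" "distinct vs"
    "C = {{vs ! i, vs ! ((i + 1) mod length vs)} | i. i < length vs}"
    unfolding is_cycle_def by blast
  let ?n = "length vs"
  have n: "?n > 0" using vs(1) by linarith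
  define nxt where "nxt p = (if p + 1 = ?n then 0 else p + 1)" for p
  define prv where "prv p = (if p = 0 then ?n - 1 else p - 1)" for p
  have C: "C = {{vs ! i, vs ! nxt i} | i. i < ?n}"
  proof -
    have "(i + 1) mod ?n = nxt i" if "i < ?n" for i
      using that by (auto simp: nxt_def mod_Suc)
    then show ?thesis unfolding vs(3) by (metis (no_types, lifting))
  qed
  have lt: "nxt p < ?n" "prv p < ?n" if "p < ?n" for p
    using that n by (auto simp: nxt_def prv_def)
  \<comment> \<open>This is where length at least 3 enters: the two neighbouring positions
    differ.\<close>
  have np: "nxt p \<noteq> prv p" if "p < ?n" for p
    using that vs(1) by (auto simp: nxt_def prv_def split: if_splits)
  have inv: "q = prv p \<longleftrightarrow> p = nxt q" if "p < ?n" "q < ?n" for p q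
    using that by (auto simp: nxt_def prv_def)
  have edge: "{vs ! p, y} \<in> C \<longleftrightarrow> y = vs ! nxt p \<or> y = vs ! prv p" if p: "p < ?n" for p y
  proof
    assume "{vs ! p, y} \<in> C"
    then obtain i where i: "i < ?n" "{vs ! p, y} = {vs ! i, vs ! nxt i}" unfolding C by blast
    then consider "vs ! p = vs ! i" "y = vs ! nxt i" | "vs ! p = vs ! nxt i" "y = vs ! i"
      by (auto simp: doubleton_eq_iff)
    then show "y = vs ! nxt p \<or> y = vs ! prv p"
    proof cases
      case 1
      then show ?thesis using nth_eq_iff_index_eq[OF vs(2) p i(1)] by simp
    next
      case 2
      then have "p = nxt i" using nth_eq_iff_index_eq[OF vs(2) p lt(1)[OF i(1)]] by simp
      then show ?thesis using inv[OF p i(1)] 2 by simp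
    qed
  next
    assume "y = vs ! nxt p \<or> y = vs ! prv p"
    moreover have "{vs ! p, vs ! nxt p} \<in> C" using p unfolding C by blast
    moreover have "{vs ! prv p, vs ! nxt (prv p)} \<in> C" using lt(2)[OF p] unfolding C by blast
    moreover have "nxt (prv p) = p" using inv[OF p lt(2)[OF p]] by simp
    ultimately show "{vs ! p, y} \<in> C" by (auto simp: insert_commute)
  qed
  from assms(2) obtain i where i: "i < ?n" "{x, a} = {vs ! i, vs ! nxt i}" unfolding C by blast
  then have "x = vs ! i \<or> x = vs ! nxt i" by (auto simp: doubleton_eq_iff)
  then obtain p where p: "p < ?n" "x = vs ! p" using i(1) lt(1) by blast
  have ne: "vs ! nxt p \<noteq> vs ! prv p"
    using nth_eq_iff_index_eq[OF vs(2) lt[OF p(1)]] np[OF p(1)] by simp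
  have "a = vs ! nxt p \<or> a = vs ! prv p" using edge[OF p(1)] p(2) assms(2) by simp
  then show thesis
  proof
    assume "a = vs ! nxt p"
    then show thesis using ne edge[OF p(1)] p(2) by (intro that[of "vs ! prv p"]) auto
  next
    assume "a = vs ! prv p"
    then show thesis using ne edge[OF p(1)] p(2) by (intro that[of "vs ! nxt p"]) auto
  qed
qed

lemma cycle_no_end:
  assumes "is_cycle G C" "\<And>y. {x, y} \<in> C \<Longrightarrow> y = a"
  shows "{x, a} \<notin> C"
  using cycle_two_edges[OF assms(1), of x a] assms(2) by metis

text \<open>A cycle using one of the two possible edges at \<open>x\<close> needs a second one
  there, which can only be the other.\<close>

lemma cycle_passes:
  assumes "is_cycle G C" "\<And>y. {x, y} \<in> C \<Longrightarrow> y = a \<or> y = b"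
  shows "{x, a} \<in> C \<longleftrightarrow> {x, b} \<in> C"
  using cycle_two_edges[OF assms(1), of x a] cycle_two_edges[OF assms(1), of x b] assms(2) by metis

section \<open>The cycles of a bouquet\<close>

definition petal_cycle :: "nat \<Rightarrow> nat \<Rightarrow> nat set set" where
  "petal_cycle c i = (\<lambda>j. {petal i j, petal i ((j + 1) mod c)}) ` {..<c}"

lemma petal_cycle_mem:
  assumes "j < c"
  shows "{petal i j, petal i ((j + 1) mod c)} \<in> petal_cycle c i"
  using assms by (auto simp: petal_cycle_def)

text \<open>Every cycle edge has an end other than the root, which reveals \<open>i\<close>; since
  the cycle has at least three vertices, the two ends determine \<open>j\<close>.\<close>

lemma petal_edge_eq:
  assumes "3 \<le> c" "j < c" "j' < c"
    "{petal i j, petal i ((j + 1) mod c)} = {petal i' j', petal i' ((j' + 1) mod c)}"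
  shows "j = j' \<and> i = i'"
proof -
  have "(j + 1) mod c = (if j + 1 = c then 0 else j + 1)"
    "(j' + 1) mod c = (if j' + 1 = c then 0 else j' + 1)"
    using assms by (auto simp: mod_Suc)
  then show ?thesis using assms
    by (auto simp: doubleton_eq_iff split: if_splits)
qed

lemma card_petal_cycle:
  assumes "3 \<le> c"
  shows "card (petal_cycle c i) = c"
  unfolding petal_cycle_def
  by (subst card_image) (use petal_edge_eq[OF assms] in \<open>auto intro!: inj_onI\<close>)

lemma petal_cycle_disjoint:
  assumes "3 \<le> c" "e \<in> petal_cycle c i" "e \<in> petal_cycle c i'"
  shows "i = i'"
  using assms petal_edge_eq[OF assms(1)] unfolding petal_cycle_def by blast

lemma is_cycle_petal_cycle:
  assumes "i \<in> I" "3 \<le> c" "c \<le> gadget_top c"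
  shows "is_cycle (bouquet c L I) (petal_cycle c i)"
  unfolding is_cycle_def
proof (intro conjI exI)
  show "petal_cycle c i \<subseteq> snd (bouquet c L I)"
    unfolding petal_cycle_def using assms(1) by (intro subsetI, unfold bouquet_edge_iff) blast
  let ?vs = "map (petal i) [0..<c]"
  show "length ?vs \<ge> 3" using assms by simp
  show "distinct ?vs" by (simp add: distinct_map inj_petal)
  show "set ?vs \<subseteq> fst (bouquet c L I)" using assms by (auto intro!: bouquet_vertices)
  have "?vs ! ((j + 1) mod c) = petal i ((j + 1) mod c)" for j
    using assms(2) by simp
  then show "petal_cycle c i = {{?vs ! j, ?vs ! ((j + 1) mod length ?vs)} | j. j < length ?vs}"
    unfolding petal_cycle_def setcompr_eq_image by (intro image_cong) auto
qed

text \<open>Tree edges lie on no cycle. Leaf edges are excluded first; then the spine is peeled from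
  its far end, each outer spine edge being the only remaining candidate at its outer vertex.\<close>

lemma bouquet_cycle_edges:
  assumes C: "is_cycle (bouquet c L I) C" and c: "3 \<le> c" and e: "e \<in> C"
  shows "\<exists>i\<in>I. e \<in> petal_cycle c i"
proof -
  have sub: "C \<subseteq> snd (bouquet c L I)" using C by (simp add: is_cycle_def)
  have pend: "{l, p} \<notin> C" if "pendant (bouquet c L I) l p" for l p
  proof (rule cycle_no_end[OF C])
    fix y assume "{l, y} \<in> C"
    then have "{l, y} \<in> snd (bouquet c L I)" using sub by (rule rev_subsetD)
    moreover have "\<forall>e\<in>snd (bouquet c L I). l \<in> e \<longrightarrow> e = {l, p}" using that by (simp add: pendant_def)
    ultimately have "{l, y} = {l, p}" by simp
    then show "y = p" by (auto simp: doubleton_eq_iff)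
  qed
  have lf: "{leaf s m, spine s} \<notin> C" if "s < 4" "m < L s" for s m
    by (rule pend[OF pendant_leaf]) (use that in auto)
  have pt: "{petal i j, petal i 2} \<notin> C" if "i \<in> I" "j \<in> {c..gadget_top c}" for i j
    by (rule pend[OF pendant_petal]) (use that c in auto)
  have sp: "{spine (s + 1), spine s} \<notin> C"
    if s: "s < 3" and up: "s + 1 < 3 \<Longrightarrow> {spine (s + 2), spine (s + 1)} \<notin> C" for s
  proof (rule cycle_no_end[OF C])
    fix y assume y: "{spine (s + 1), y} \<in> C"
    then have "{spine (s + 1), y} \<in> snd (bouquet c L I)" using sub by blast
    then show "y = spine s"
      unfolding bouquet_edge_iff
    proof (elim disjE exE bexE conjE)
      fix s' assume s': "s' < 3" "{spine (s + 1), y} = {spine s', spine (s' + 1)}"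
      then consider "s' = s + 1" "y = spine (s + 2)" | "y = spine s"
        by (auto simp: doubleton_eq_iff)
      then show ?thesis
      proof cases
        case 1
        then show ?thesis using up s' y by (simp add: insert_commute)
      qed
    next
      fix s' m assume "s' < 4" "m < L s'" "{spine (s + 1), y} = {spine s', leaf s' m}"
      then show ?thesis using lf[of s' m] y by (simp add: insert_commute)
    qed (auto simp: doubleton_eq_iff)
  qed
  \<comment> \<open>The peeling starts at the end of the spine, where the condition on the next
    outer edge is vacuous.\<close>
  have "{spine 3, spine 2} \<notin> C" using sp[of 2] by (simp add: numeral_3_eq_3 numeral_2_eq_2)
  moreover then have "{spine 2, spine 1} \<notin> C" using sp[of 1] by (simp add: numeral_3_eq_3 numeral_2_eq_2)
  moreover then have "{spine 1, spine 0} \<notin> C" using sp[of 0] by (simp add: numeral_3_eq_3 numeral_2_eq_2)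
  ultimately have sp': "{spine s, spine (s + 1)} \<notin> C" if "s < 3" for s
  proof -
    from that consider "s = 0" | "s = 1" | "s = 2" by linarith
    then show ?thesis
      using \<open>{spine 3, spine 2} \<notin> C\<close> \<open>{spine 2, spine 1} \<notin> C\<close> \<open>{spine 1, spine 0} \<notin> C\<close>
      by cases (simp_all add: insert_commute numeral_3_eq_3 numeral_2_eq_2)
  qed
  have "e \<in> snd (bouquet c L I)" using e sub by blast
  then show ?thesis
    unfolding bouquet_edge_iff
  proof (elim disjE exE bexE conjE)
    show ?thesis if "s < 3" "e = {spine s, spine (s + 1)}" for s
      using sp' that e by blast
    show ?thesis if "s < 4" "m < L s" "e = {spine s, leaf s m}" for s m
      using lf that e by (simp add: insert_commute)
    show ?thesis if "i \<in> I" "j < c" "e = {petal i j, petal i ((j + 1) mod c)}" for i j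
      using that petal_cycle_mem by blast
    show ?thesis if "i \<in> I" "j \<in> {c..gadget_top c}" "e = {petal i 2, petal i j}" for i j
      using pt that e by (simp add: insert_commute)
  qed
qed

text \<open>Away from the root, consecutive edges of a petal meet at a vertex with no other edge in
  a cycle, so a cycle contains all cycle edges of a petal or none. Two full petals would give the
  root too many edges.\<close>

lemma bouquet_cycle_is_petal:
  assumes C: "is_cycle (bouquet c L I) C" and c: "3 \<le> c"
  shows "\<exists>i\<in>I. C = petal_cycle c i"
proof -
  note cover = bouquet_cycle_edges[OF C c]
  define E where "E i j = {petal i j, petal i ((j + 1) mod c)}" for i j
  \<comment> \<open>The shared vertex has index \<open>j + 1\<close>, which is not 0, so it belongs
    to petal \<open>i\<close> only.\<close>
  have step: "E i j \<in> C \<longleftrightarrow> E i (j + 1) \<in> C" if "j + 1 < c" for i j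
  proof -
    let ?x = "petal i (j + 1)" and ?b = "petal i ((j + 1 + 1) mod c)"
    have "{?x, petal i j} \<in> C \<longleftrightarrow> {?x, ?b} \<in> C"
    proof (rule cycle_passes[OF C])
      fix y assume "{?x, y} \<in> C"
      from cover[OF this] obtain i' j' where
        j': "j' < c" "{?x, y} = {petal i' j', petal i' ((j' + 1) mod c)}"
        unfolding petal_cycle_def by blast
      then consider "?x = petal i' j'" "y = petal i' ((j' + 1) mod c)"
        | "?x = petal i' ((j' + 1) mod c)" "y = petal i' j'"
        by (auto simp: doubleton_eq_iff)
      then show "y = petal i j \<or> y = ?b"
      proof cases
        case 1
        then show ?thesis by simp
      next
        case 2
        then have "i = i'" "j + 1 = (j' + 1) mod c" by auto
        then have "j' = j" using j'(1) by (auto simp: mod_Suc split: if_splits)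
        then show ?thesis using 2 \<open>i = i'\<close> by simp
      qed
    qed
    then show ?thesis using that by (simp add: E_def insert_commute)
  qed
  have all: "E i j \<in> C \<longleftrightarrow> E i 0 \<in> C" if "j < c" for i j
    using that by (induction j) (use step in auto)
  have cyc: "petal_cycle c i = E i ` {..<c}" for i by (simp add: petal_cycle_def E_def)
  have full: "petal_cycle c i \<subseteq> C" if "e \<in> petal_cycle c i" "e \<in> C" for i e
    using that all unfolding cyc by auto
  obtain vs where "length vs \<ge> 3" "C = {{vs ! i, vs ! ((i + 1) mod length vs)} | i. i < length vs}"
    using C unfolding is_cycle_def by blast
  moreover from this(1) have "0 < length vs" by linarith
  ultimately obtain e where e: "e \<in> C" by blast
  from cover[OF e] obtain i where i: "i \<in> I" "e \<in> petal_cycle c i" by blast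
  have root: "{spine 0, petal i 1} \<in> C \<and> {spine 0, petal i (c - 1)} \<in> C"
    if "petal_cycle c i \<subseteq> C" for i
  proof -
    have "E i 0 \<in> C" "E i (c - 1) \<in> C" using that c unfolding cyc by auto
    then show ?thesis using c by (simp add: E_def petal_def insert_commute split: if_splits)
  qed
  have "e' \<in> petal_cycle c i" if e': "e' \<in> C" for e'
  proof -
    from cover[OF e'] obtain i' where i': "i' \<in> I" "e' \<in> petal_cycle c i'" by blast
    have "i' = i"
    proof (rule ccontr)
      assume "i' \<noteq> i"
      \<comment> \<open>Both edges of the cycle at the root already lie in petal \<open>i\<close>,
        so the root edge of petal \<open>i'\<close> has no room.\<close>
      obtain b where b: "\<And>y. {spine 0, y} \<in> C \<longleftrightarrow> y = petal i 1 \<or> y = b"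
        using cycle_two_edges[OF C] root[OF full[OF i(2) e]] by metis
      then have "b = petal i (c - 1)" using root[OF full[OF i(2) e]] c by fastforce
      then have "petal i' 1 = petal i 1 \<or> petal i' 1 = petal i (c - 1)"
        using root[OF full[OF i'(2) e']] b by blast
      with \<open>i' \<noteq> i\<close> show False using c by simp
    qed
    then show ?thesis using i'(2) by simp
  qed
  then show ?thesis using full[OF i(2) e] i(1) by blast
qed

subsection \<open>Their good vertices\<close>

text \<open>The leaf counts are tuned so that after removing one petal the remaining graph, with
  \<open>m + 1\<close> vertices, has root transmission \<open>3 * m + c - 13\<close>. Leaves at depth 3 do not affect
  this relation, so their number \<open>t + 1\<close> is free.\<close>

definition leaf_counts :: "nat \<Rightarrow> nat \<Rightarrow> nat \<Rightarrow> nat \<Rightarrow> nat" where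
  "leaf_counts c k t s = (if s = 0 then 6 else if s = 1 then 1 else if s = 2 then t + 1
     else 6 * k + c - 3)"

definition flower :: "nat \<Rightarrow> nat \<Rightarrow> nat \<Rightarrow> nat graph" where
  "flower c k t = bouquet c (leaf_counts c k t) {..<k}"

text \<open>A leaf at \<open>spine s\<close> adds 1 to the vertex count and \<open>s + 1\<close> to
  the root transmission, hence changes transmission minus three times the vertex count by
  \<open>s - 2\<close>. The counts at \<open>s\<close> = 0, 1 and 3 use this to set that difference.
  The \<open>+ 1\<close> in the second equation avoids truncated subtraction.\<close>

lemma leaf_counts_sum:
  assumes "3 \<le> c"
  shows "(\<Sum>s<4. leaf_counts c k t s) = 5 + t + 6 * k + c"
    "(\<Sum>s<4. (s + 1) * leaf_counts c k t s) + 1 = 3 * t + 24 * k + 4 * c"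
  using assms by (simp_all add: leaf_counts_def eval_nat_numeral)

lemma flower_values:
  assumes "c \<in> {5, 6}"
  shows "simple_graph (flower c k t)" "connected_graph (flower c k t)"
    "card (fst (flower c k t)) = 9 + t + 6 * k + c + k * gadget_top c"
  using bouquet_values[OF assms finite_lessThan[of k], of "leaf_counts c k t"]
    leaf_counts_sum(1)[of c k t] assms by (auto simp: flower_def)

lemma finite_flower: "c \<in> {5, 6} \<Longrightarrow> finite (fst (flower c k t))"
  using flower_values(1) simple_graph_def by blast

text \<open>Split the flower into petal \<open>i\<close> and the rest and apply
  \<open>good_vertex_glue\<close>; only the vertex count and root transmission of the rest
  enter.\<close>

lemma good_vertex_petal:
  assumes c: "c \<in> {5, 6}" and i: "i < k" and j: "j = 1 \<or> j \<in> {3..<c}"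
  shows "good_vertex (flower c k t) (petal i j) \<longleftrightarrow> j = 1"
proof -
  let ?I = "{..<k} - {i}"
  let ?A = "bouquet c (leaf_counts c k t) ?I" and ?B = "graph_image (petal i) (gadget c)"
  have I: "finite ?I" "card ?I = k - 1" "i \<notin> ?I" "insert i ?I = {..<k}" using i by auto
  have flower: "flower c k t = glue ?A ?B" by (simp only: flower_def bouquet_insert[symmetric] I(4))
  define m where "m = 8 + t + 6 * k + c + (k - 1) * gadget_top c"
  have A: "simple_graph ?A" "connected_graph ?A"
    "card (fst ?A) = 4 + (\<Sum>s<4. leaf_counts c k t s) + card ?I * gadget_top c"
    "trans_sum ?A (spine 0) =
      6 + (\<Sum>s<4. (s + 1) * leaf_counts c k t s) + card ?I * (3 * gadget_top c - 6)"
    using bouquet_values[OF c I(1), of "leaf_counts c k t"] by blast+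
  have c3: "3 \<le> c" using c by (elim insertE emptyE) simp_all
  have A': "connected_graph ?A" "edges_within ?A" "finite (fst ?A)"
    using A(2) simple_graph_edges_within[OF A(1)] A(1)[unfolded simple_graph_iff] by blast+
  have cardA: "card (fst ?A) = Suc m"
    unfolding A(3) I(2) leaf_counts_sum(1)[OF c3] by (simp add: m_def)
  \<comment> \<open>Each of the \<open>k - 1\<close> other petals has transmission 6 below three
    times its number of non-root vertices; the \<open>6 * k\<close> in the leaf count at
    \<open>spine 3\<close> makes up for this.\<close>
  have tA: "trans_sum ?A (spine 0) + 13 = 3 * m + c"
  proof -
    obtain k' where k': "k = Suc k'" using i by (cases k) auto
    have "3 * gadget_top c - 6 + 6 = 3 * gadget_top c" by (auto simp: gadget_top_def)
    then have "k' * (3 * gadget_top c - 6) + 6 * k' = 3 * (k' * gadget_top c)"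
      by (metis add_mult_distrib2 mult.commute mult.left_commute)
    then show ?thesis using A(4)[unfolded I(2)] leaf_counts_sum(2)[OF c3, of k t] by (simp add: m_def k')
  qed
  note B = petal_gadget[OF c, of i]
  note AB = petal_inter_bouquet[OF I(3), of c "leaf_counts c k t"]
  have jt: "j \<in> fst (gadget c)" "j \<noteq> 0" using j gadget_top_ge[OF c] c3 by (auto simp: fst_gadget)
  note g = gadget_values[OF c] and d = gadget_delete_values[OF c j]
  let ?D = "delete_vertex (gadget c) j"
  have zero: "0 \<in> fst ?D" using jt by (simp add: fst_gadget)
  have ew: "edges_within ?D" by (rule edges_within_delete[OF g(2)])
  have del: "delete_vertex ?B (petal i j) = graph_image (petal i) ?D"
    by (rule delete_vertex_graph_image[OF inj_petal g(2) jt(1)])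
  have D: "connected_graph (delete_vertex ?B (petal i j))"
    "dist_sum (delete_vertex ?B (petal i j)) = dist_sum ?D"
    "trans_sum (delete_vertex ?B (petal i j)) (spine 0) = trans_sum ?D 0"
    using connected_graph_image[OF inj_petal ew d(1)] zero
      dist_sum_graph_image[OF inj_petal ew d(1)]
      trans_sum_graph_image[OF inj_petal ew d(1) zero, of i]
    unfolding del by (auto simp: petal_def)
  have dB: "dist_sum ?B = dist_sum (gadget c)"
    by (rule dist_sum_graph_image[OF inj_petal g(2,1)])
  have "trans_sum ?B (spine 0) = trans_sum (gadget c) 0" using B(5) g(3) by simp
  moreover have "petal i j \<in> fst ?B" using jt by (simp add: graph_image_def)
  moreover have "petal i j \<noteq> spine 0" using jt by simp
  ultimately have good: "good_vertex (flower c k t) (petal i j) \<longleftrightarrow>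
    dist_sum (gadget c) + 2 * trans_sum ?A (spine 0) + 2 * m * trans_sum (gadget c) 0 =
    dist_sum ?D + 2 * m * trans_sum ?D 0"
    unfolding flower using good_vertex_glue[OF A'(1-3) cardA B(1-3) AB _ _ D(1)] D dB by simp
  show ?thesis
  proof (cases "j = 1")
    case True
    \<comment> \<open>Goodness now reads
      \<open>2 * trans_sum ?A (spine 0) + 26 = 6 * m + 2 * c\<close>, which is \<open>tA\<close>
      doubled.\<close>
    then have "2 * m * trans_sum ?D 0 = 2 * m * trans_sum (gadget c) 0 + 6 * m"
      using d(3) by (simp add: algebra_simps)
    then show ?thesis unfolding good using True d(2) tA by simp
  next
    case False
    have "2 * m * trans_sum ?D 0 \<le> 2 * m * (trans_sum (gadget c) 0 + 1)"
      by (rule mult_left_mono[OF d(5)[OF False]]) simp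
    then have "2 * m * trans_sum ?D 0 \<le> 2 * m * trans_sum (gadget c) 0 + 2 * m" by simp
    \<comment> \<open>Goodness would force \<open>2 * trans_sum ?A (spine 0) <= 2 * m + 10\<close>,
      whereas by \<open>tA\<close> the left side is 6m + 2c - 26, which is larger for such
      \<open>m\<close>.\<close>
    moreover have "m \<ge> 13" using c by (auto simp: m_def)
    ultimately show ?thesis unfolding good using False d(4)[OF False] tA by linarith
  qed
qed

text \<open>Every vertex is a leaf, a neighbour of a leaf, or a petal vertex of degree 2 covered by
  \<open>good_vertex_petal\<close>.\<close>

lemma good_vertices_flower:
  assumes c: "c \<in> {5, 6}"
  shows "{v \<in> fst (flower c k t). good_vertex (flower c k t) v} = (\<lambda>i. petal i 1) ` {..<k}"
proof (intro equalityI subsetI)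
  let ?G = "flower c k t"
  note G = finite_flower[OF c, of k t] flower_values(2)[OF c, of k t]
  have c2: "2 < c" "c \<le> gadget_top c" using c gadget_top_ge[OF c] by auto
  have spine: "spine s \<in> fst ?G" if "s < 4" for s using that by (simp add: flower_def bouquet_vertices)
  fix v assume "v \<in> {v \<in> fst ?G. good_vertex ?G v}"
  then have v: "v \<in> fst ?G" "good_vertex ?G v" by auto
  from v(1)[unfolded flower_def] show "v \<in> (\<lambda>i. petal i 1) ` {..<k}"
  proof (cases rule: bouquet_vertex_cases)
    case (1 s)
    \<comment> \<open>Every spine vertex bears a leaf; this is why the free count is
      \<open>t + 1\<close> and not \<open>t\<close>.\<close>
    have "0 < leaf_counts c k t s" using c by (auto simp: leaf_counts_def)
    then have "pendant ?G (leaf s 0) v"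
      unfolding flower_def 1(2) by (intro pendant_leaf 1(1))
    moreover define w where "w = spine (if s = 0 then 1 else 0)"
    then have "w \<in> fst ?G" "w \<noteq> leaf s 0" "w \<noteq> v" using 1 spine by auto
    ultimately show ?thesis using pendant_neighbour_not_good[OF G] v(2) by blast
  next
    case (2 s m)
    have "pendant ?G v (spine s)" unfolding flower_def 2(3) by (intro pendant_leaf 2(1,2))
    then show ?thesis using pendant_not_good[OF G] v(2) by blast
  next
    case (3 i j)
    have pend: "pendant ?G (petal i j') (petal i 2)" if "j' \<in> {c..gadget_top c}" for j'
      unfolding flower_def by (rule pendant_petal[OF 3(1) c2(1) that])
    consider "j = 1 \<or> j \<in> {3..<c}" | "j = 2" | "j \<in> {c..gadget_top c}"
      using 3 by fastforce
    then show ?thesis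
    proof cases
      case 1
      then have "j = 1" using good_vertex_petal[OF c _ 1, of i k t] 3 v(2) by simp
      then show ?thesis using 3 by blast
    next
      case 2
      have "pendant ?G (petal i c) v" unfolding 3(4) 2 using c2 by (intro pend) simp
      moreover have "spine 0 \<noteq> petal i c" "spine 0 \<noteq> v" using c2 3 by auto
      ultimately show ?thesis
        using pendant_neighbour_not_good[OF G] spine[of 0] v(2) by (meson zero_less_numeral)
    next
      case 3
      then show ?thesis using pendant_not_good[OF G pend] v(2) \<open>v = petal i j\<close> by blast
    qed
  qed
next
  let ?G = "flower c k t"
  fix v assume "v \<in> (\<lambda>i. petal i 1) ` {..<k}"
  then obtain i where i: "i < k" "v = petal i 1" by auto
  then have "good_vertex ?G v" using good_vertex_petal[OF c i(1), of 1 t] by simp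
  then show "v \<in> {v \<in> fst ?G. good_vertex ?G v}" by (simp add: good_vertex_def)
qed

section \<open>The cactus property and the number of cycles\<close>

lemma cycles_flower:
  assumes c: "c \<in> {5, 6}"
  shows "is_cycle (flower c k t) C \<longleftrightarrow> C \<in> petal_cycle c ` {..<k}"
proof -
  have "3 \<le> c" using c by auto
  then show ?thesis
    using bouquet_cycle_is_petal[of c _ "{..<k}" C] is_cycle_petal_cycle[of _ "{..<k}" c]
      gadget_top_ge[OF c] unfolding flower_def by blast
qed

text \<open>The only cycles are the petal cycles, and these are pairwise edge-disjoint.\<close>

lemma cactus_flower:
  assumes c: "c \<in> {5, 6}"
  shows "cactus (flower c k t)"
  unfolding cactus_def
proof (intro conjI ballI)
  have c3: "3 \<le> c" using c by auto
  show "simple_graph (flower c k t)" "connected_graph (flower c k t)" by (fact flower_values[OF c])+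
  show "fst (flower c k t) \<noteq> {}" using flower_values(3)[OF c, of k t] by auto
  fix e
  let ?Z = "{C. is_cycle (flower c k t) C \<and> e \<in> C}"
  have "C = C'" if "C \<in> ?Z" "C' \<in> ?Z" for C C'
    using that petal_cycle_disjoint[OF c3, of e] unfolding cycles_flower[OF c] by auto
  moreover have "finite ?Z" unfolding cycles_flower[OF c] by simp
  ultimately show "card ?Z \<le> 1" by (simp only: One_nat_def card_le_Suc0_iff_eq) blast
qed

lemma card_cycles_flower:
  assumes c: "c \<in> {5, 6}"
  shows "card (cycles_of_length (flower c k t) c) = k"
proof -
  have c3: "3 \<le> c" using c by auto
  have "cycles_of_length (flower c k t) c = petal_cycle c ` {..<k}"
    unfolding cycles_of_length_def cycles_flower[OF c] using card_petal_cycle[OF c3] by auto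
  moreover have "inj_on (petal_cycle c) {..<k}"
  proof (rule inj_onI)
    fix i i' assume "petal_cycle c i = petal_cycle c i'"
    then show "i = i'"
      using petal_cycle_disjoint[OF c3 petal_cycle_mem[of 0 c i]] petal_cycle_mem[of 0 c i] c3 by simp
  qed
  ultimately show ?thesis by (simp add: card_image)
qed

theorem theorem3:
  fixes k c :: nat
  assumes "c \<in> {5, 6}"
  shows "\<exists>S :: nat graph set. infinite S \<and>
           (\<forall>G\<in>S. cactus G \<and> card (cycles_of_length G c) = k \<and>
                    card {v \<in> fst G. good_vertex G v} = k) \<and>
           (\<forall>G\<in>S. \<forall>H\<in>S. G \<noteq> H \<longrightarrow> \<not> graph_iso G H)"
proof (intro exI conjI)
  let ?S = "range (flower c k)"
  \<comment> \<open>The vertex count grows with \<open>t\<close> and is invariant under isomorphism;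
    this yields both infinitude and pairwise non-isomorphism.\<close>
  have inj: "t = t'" if "card (fst (flower c k t)) = card (fst (flower c k t'))" for t t'
    using that by (simp add: flower_values(3)[OF assms])
  show "infinite ?S" by (rule range_inj_infinite) (metis injI inj)
  have "card ((\<lambda>i. petal i 1) ` {..<k}) = k" by (simp add: card_image inj_on_def)
  then show "\<forall>G\<in>?S. cactus G \<and> card (cycles_of_length G c) = k \<and>
      card {v \<in> fst G. good_vertex G v} = k"
    by (auto simp: cactus_flower[OF assms] card_cycles_flower[OF assms] good_vertices_flower[OF assms])
  show "\<forall>G\<in>?S. \<forall>H\<in>?S. G \<noteq> H \<longrightarrow> \<not> graph_iso G H"
    using inj bij_betw_same_card unfolding graph_iso_def by blast
qed

end
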